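(* Let $(X,\rho,\mu)_{d,\theta}$ be a space of homogeneous type and let $1\leqslant p\leqslant\infty$. Then, given $0<\varepsilon<1$ and $K>0$, there exist a set of points $\{a_n\}_n$ in $X$ and constants $c_1,c_2>0$ such that $$c_1(1-\varepsilon)\|f\|_{L^p}\leqslant\Bigl(\sum_n|f(a_n)|^p\Bigr)^{1/p}\leqslant c_2(1+\varepsilon)\|f\|_{L^p}$$ holds for all $f\in B^{d/p}_{p,1}(X)$ with $\|f\|_{B^{d/p}_{p,1}}\leqslant K\|f\|_{L^p}$.
   Context: **Space of homogeneous type.** A quasi-metric on a set $X$ is a function $\rho:X\times X\to[0,\infty)$ such that $\rho(x,y)=0$ iff $x=y$; $\rho(x,y)=\rho(y,x)$; and there is a constant $A>0$ with $\rho(x,y)\leqslant A(\rho(x,z)+\rho(z,y))$ for all $x,y,z\in X$. Write $B(x,r)$ for the $\rho$-ball of center $x$ and radius $r$. A space of homogeneous type $(X,\rho,\mu)_{d,\theta}$ is a set $X$ with a quasi-metric $\rho$ and a non-negative Borel measure $\mu$, where $d>0$ and $0<\theta\leqslant 1$ are such that there is a constant $C>0$ with, for all $0<r<\mathrm{diam}(X)$ and all $x,x',y\in X$, $$C^{-1}r^d\leqslant\mu(B(x,r))\leqslant Cr^d,\qquad |\rho(x,y)-\rho(x',y)|\leqslant C\rho(x,x')^\theta(\rho(x,y)+\rho(x',y))^{1-\theta}.$$ $L^p=L^p(X,\mu)$. **Dyadic cubes** (Hytönen–Kairema). A system of dyadic cubes is a family of countable collections $\{Q^j_k\}_{k\in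 I_j}$, $j\in\mathbb Z$, of Borel subsets of $X$ such that: (i) $X=\bigcup_{k\in I_j}Q^j_k$ for every $j$; (ii) there are constants $r_0,r_1>0$ such that for each $(j,k)$ there is a point $y^j_k\in Q^j_k$ (a center of the cube) with $B(y^j_k,r_02^{-j})\subset Q^j_k\subset B(y^j_k,r_12^{-j})$; (iii) if $i\geqslant j$ then either $Q^i_{k'}\subset Q^j_k$ or $Q^i_{k'}\cap Q^j_k=\emptyset$, and cubes of the same level $j$ with distinct indices are disjoint; (iv) for each $(j,k)$ and $i<j$ there is a unique $k'$ with $Q^j_k\subset Q^i_{k'}$. Such a system exists; one is fixed. **Wavelets.** $\{\varphi_{j,k}\},\{\psi_{j,k}\}$ ($j\in\mathbb Z$, $k\in I_j$) denote the wavelet system and its dual system constructed by Deng and Han (in their book Harmonic Analysis on Spaces of Homogeneous Type) from the fixed dyadic cubes with centers $y^j_k$. There is a constant $C_\varphi>0$ such that $\varphi_{j,k}(x)=0$ if $\rho(x,y^j_k)\geqslant C_\varphi2^{-j}$; $\|\varphi_{j,k}\|_\infty\leqslant C_\varphi2^{jd/2}$; $|\varphi_{j,k}(x)-\varphi_{j,k}(y)|\leqslant C_\varphi2^{j(d/2+\theta)}\rho(x,y)^\theta$ for all $x,y\in X$; and $f=\sum_{j\in\mathbb Z}\sum_{k\in I_j}\langle f,\psi_{j,k}\rangle\varphi_{j,k}$ for all $f\in L^2(X)$. The coefficients $\langle f,\psi_{j,k}\rangle$ make sense for $f\in L^1_{loc}$. **Besov spaces.** For $0<p,q\leqslant\infty$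 and $s\in\mathbb R$, $B^s_{p,q}(X)$ is the set of $f\in L^1_{loc}$ for which $$\|f\|_{B^s_{p,q}}:=\Bigl(\sum_{j\in\mathbb Z}\Bigl[2^{j\left(s+d\left[\frac12-\frac1p\right]\right)}\Bigl(\sum_{k\in I_j}|\langle f,\psi_{j,k}\rangle|^p\Bigr)^{1/p}\Bigr]^q\Bigr)^{1/q}$$ is finite, with sup-norms replacing the $p$- or $q$-sums when $p=\infty$ or $q=\infty$. **Conventions.** For $p=\infty$, $d/p=0$ and $\left(\sum_n|f(a_n)|^p\right)^{1/p}$ means $\sup_n|f(a_n)|$. The index set of $\{a_n\}_n$ is countable. Functions $f\in B^{d/p}_{p,1}(X)$ are identified with the continuous function given pointwise by $f(x)=\sum_{j}\sum_{k}\langle f,\psi_{j,k}\rangle\varphi_{j,k}(x)$, so that $f(a_n)$ is meaningful. The conditions and inequalities involving $\|f\|_{L^p}$ are understood for $f$ with $\|f\|_{L^p}<\infty$. *)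

theory Defs
  imports "HOL-Probability.Essential_Supremum" "HOL-Library.Countable_Set"
begin

section \<open>Spaces of homogeneous type\<close>

text \<open>
  The underlying set \<open>X\<close> is the \<^const>\<open>space\<close> of the measure \<open>M\<close>; all conditions are relative to it.
\<close>

definition quasi_metric_on :: "'a set \<Rightarrow> ('a \<Rightarrow> 'a \<Rightarrow> real) \<Rightarrow> bool" where
  "quasi_metric_on X \<rho> \<longleftrightarrow>
     (\<forall>x\<in>X. \<forall>y\<in>X. 0 \<le> \<rho> x y \<and> (\<rho> x y = 0 \<longleftrightarrow> x = y) \<and> \<rho> x y = \<rho> y x) \<and>
     (\<exists>A>0. \<forall>x\<in>X. \<forall>y\<in>X. \<forall>z\<in>X. \<rho> x y \<le> A * (\<rho> x z + \<rho> z y))"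

definition qball :: "'a set \<Rightarrow> ('a \<Rightarrow> 'a \<Rightarrow> real) \<Rightarrow> 'a \<Rightarrow> real \<Rightarrow> 'a set" where
  "qball X \<rho> x r = {y \<in> X. \<rho> x y < r}"

definition qopen :: "'a set \<Rightarrow> ('a \<Rightarrow> 'a \<Rightarrow> real) \<Rightarrow> 'a set \<Rightarrow> bool" where
  "qopen X \<rho> U \<longleftrightarrow> U \<subseteq> X \<and> (\<forall>x\<in>U. \<exists>r>0. qball X \<rho> x r \<subseteq> U)"

definition qdiam :: "'a set \<Rightarrow> ('a \<Rightarrow> 'a \<Rightarrow> real) \<Rightarrow> ereal" where
  "qdiam X \<rho> = (SUP x\<in>X. SUP y\<in>X. ereal (\<rho> x y))"

text \<open>
  Balls of every radius are required to have finite measure, the usual convention for spaces of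
  homogeneous type. If \<open>X\<close> is unbounded this follows from the upper bound on the measure of balls;
  it only excludes bounded spaces of infinite total measure, which are invisible to the bounds for
  radii strictly below the diameter.
\<close>

definition homogeneous_type :: "'a measure \<Rightarrow> ('a \<Rightarrow> 'a \<Rightarrow> real) \<Rightarrow> real \<Rightarrow> real \<Rightarrow> bool" where
  "homogeneous_type M \<rho> d \<theta> \<longleftrightarrow>
     quasi_metric_on (space M) \<rho> \<and>
     sets M = sigma_sets (space M) {U. qopen (space M) \<rho> U} \<and>
     (\<forall>x\<in>space M. \<forall>r>0. emeasure M (qball (space M) \<rho> x r) < \<infinity>) \<and>
     0 < d \<and> 0 < \<theta> \<and> \<theta> \<le> 1 \<and>
     (\<exists>C>0.
        (\<forall>r>0. ereal r < qdiam (space M) \<rho> \<longrightarrow>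
           (\<forall>x\<in>space M.
              ennreal (r powr d / C) \<le> emeasure M (qball (space M) \<rho> x r) \<and>
              emeasure M (qball (space M) \<rho> x r) \<le> ennreal (C * r powr d))) \<and>
        (\<forall>x\<in>space M. \<forall>x'\<in>space M. \<forall>y\<in>space M.
           \<bar>\<rho> x y - \<rho> x' y\<bar> \<le> C * \<rho> x x' powr \<theta> * (\<rho> x y + \<rho> x' y) powr (1 - \<theta>)))"


section \<open>Dyadic cubes\<close>

text \<open>
  \<open>I j\<close> is the index set of the cubes of generation \<open>j\<close>, \<open>Q j k\<close> the cube and \<open>y j k\<close> its center.
\<close>

definition dyadic_cubes ::
  "'a measure \<Rightarrow> ('a \<Rightarrow> 'a \<Rightarrow> real) \<Rightarrow> (int \<Rightarrow> 'k set) \<Rightarrow> (int \<Rightarrow> 'k \<Rightarrow> 'a set) \<Rightarrow> (int \<Rightarrow> 'k \<Rightarrow> 'a) \<Rightarrow> bool"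
where
  "dyadic_cubes M \<rho> I Q y \<longleftrightarrow>
     (\<forall>j. countable (I j)) \<and>
     (\<forall>j. \<forall>k\<in>I j. Q j k \<in> sets M) \<and>
     (\<forall>j. space M = (\<Union>k\<in>I j. Q j k)) \<and>
     (\<exists>r\<^sub>0>0. \<exists>r\<^sub>1>0. \<forall>j. \<forall>k\<in>I j.
        y j k \<in> Q j k \<and>
        qball (space M) \<rho> (y j k) (r\<^sub>0 * 2 powr (- real_of_int j)) \<subseteq> Q j k \<and>
        Q j k \<subseteq> qball (space M) \<rho> (y j k) (r\<^sub>1 * 2 powr (- real_of_int j))) \<and>
     (\<forall>i j. j \<le> i \<longrightarrow> (\<forall>k'\<in>I i. \<forall>k\<in>I j. Q i k' \<subseteq> Q j k \<or> Q i k' \<inter> Q j k = {})) \<and>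
     (\<forall>j. \<forall>k\<in>I j. \<forall>k'\<in>I j. k \<noteq> k' \<longrightarrow> Q j k \<inter> Q j k' = {}) \<and>
     (\<forall>i j. i < j \<longrightarrow> (\<forall>k\<in>I j. \<exists>!k'. k' \<in> I i \<and> Q j k \<subseteq> Q i k'))"


section \<open>Lebesgue norms\<close>

text \<open>Positive real powers of extended nonnegative numbers, for exponents \<open>a > 0\<close>.\<close>

definition ennpow :: "ennreal \<Rightarrow> real \<Rightarrow> ennreal" where
  "ennpow t a = (if t = \<infinity> then \<infinity> else ennreal (enn2real t powr a))"

text \<open>
  The \<open>L\<^sup>p\<close> norm, \<open>0 < p \<le> \<infinity>\<close>, of a function with values in \<open>[0, \<infinity>]\<close>. With the counting measure
  on a set \<open>A\<close> this is the \<open>\<ell>\<^sup>p\<close> norm over \<open>A\<close>, which is the supremum over \<open>A\<close> for \<open>p = \<infinity>\<close>.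
\<close>

definition Lp_ennnorm :: "'a measure \<Rightarrow> ennreal \<Rightarrow> ('a \<Rightarrow> ennreal) \<Rightarrow> ennreal" where
  "Lp_ennnorm M p g =
     (if p = \<infinity> then esssup M g
      else ennpow (\<integral>\<^sup>+x. ennpow (g x) (enn2real p) \<partial>M) (1 / enn2real p))"

definition Lp_norm :: "'a measure \<Rightarrow> ennreal \<Rightarrow> ('a \<Rightarrow> complex) \<Rightarrow> ennreal" where
  "Lp_norm M p f = Lp_ennnorm M p (\<lambda>x. ennreal (norm (f x)))"

abbreviation lp_norm :: "'b set \<Rightarrow> ennreal \<Rightarrow> ('b \<Rightarrow> complex) \<Rightarrow> ennreal" where
  "lp_norm A p c \<equiv> Lp_norm (count_space A) p c"

definition L1_loc :: "'a measure \<Rightarrow> ('a \<Rightarrow> 'a \<Rightarrow> real) \<Rightarrow> ('a \<Rightarrow> complex) set" where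
  "L1_loc M \<rho> = {f \<in> borel_measurable M.
     \<forall>x\<in>space M. \<forall>r>0. set_integrable M (qball (space M) \<rho> x r) f}"


section \<open>Wavelets\<close>

definition inner_L2 :: "'a measure \<Rightarrow> ('a \<Rightarrow> complex) \<Rightarrow> ('a \<Rightarrow> complex) \<Rightarrow> complex" where
  "inner_L2 M f g = (LINT x|M. f x * cnj (g x))"

text \<open>
  The properties of the wavelets \<open>\<phi>\<close> of Deng and Han and of the dual wavelets \<open>\<psi>\<close>, for cubes with
  centers \<open>y j k\<close>. The size estimate on \<open>\<psi> j k\<close> is part of the construction: up to the factor
  \<open>2\<^bsup>-jd/2\<^esup>\<close>, the dual wavelets are test functions, uniformly in \<open>j\<close> and \<open>k\<close>, centered at \<open>y j k\<close> and
  of width \<open>r = 2\<^bsup>-j\<^esup>\<close>, that is, bounded by a multiple of \<open>r\<^bsup>\<gamma>\<^esup> / (r + \<rho> x (y j k))\<^bsup>d + \<gamma>\<^esup>\<close>.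
  The wavelet expansion converges in \<open>L\<^sup>2\<close>, as a net over the finite sets of indices.
\<close>

definition wavelet_system ::
  "'a measure \<Rightarrow> ('a \<Rightarrow> 'a \<Rightarrow> real) \<Rightarrow> real \<Rightarrow> real \<Rightarrow> (int \<Rightarrow> 'k set) \<Rightarrow> (int \<Rightarrow> 'k \<Rightarrow> 'a) \<Rightarrow>
   (int \<Rightarrow> 'k \<Rightarrow> 'a \<Rightarrow> complex) \<Rightarrow> (int \<Rightarrow> 'k \<Rightarrow> 'a \<Rightarrow> complex) \<Rightarrow> bool"
where
  "wavelet_system M \<rho> d \<theta> I y \<phi> \<psi> \<longleftrightarrow>
     (\<forall>j. \<forall>k\<in>I j. \<phi> j k \<in> borel_measurable M \<and> \<psi> j k \<in> borel_measurable M) \<and>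
     (\<exists>C>0. \<forall>j. \<forall>k\<in>I j.
        (\<forall>x\<in>space M. C * 2 powr (- real_of_int j) \<le> \<rho> x (y j k) \<longrightarrow> \<phi> j k x = 0) \<and>
        (\<forall>x\<in>space M. norm (\<phi> j k x) \<le> C * 2 powr (real_of_int j * d / 2)) \<and>
        (\<forall>x\<in>space M. \<forall>x'\<in>space M.
           norm (\<phi> j k x - \<phi> j k x') \<le> C * 2 powr (real_of_int j * (d / 2 + \<theta>)) * \<rho> x x' powr \<theta>)) \<and>
     (\<exists>C>0. \<exists>\<gamma>>0. \<forall>j. \<forall>k\<in>I j. \<forall>x\<in>space M.
        norm (\<psi> j k x) \<le> C * 2 powr (real_of_int j * d / 2)
                          * (1 + 2 powr real_of_int j * \<rho> x (y j k)) powr (- (d + \<gamma>))) \<and>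
     (\<forall>f\<in>borel_measurable M. Lp_norm M 2 f < \<infinity> \<longrightarrow>
        ((\<lambda>F. Lp_norm M 2 (\<lambda>x. f x - (\<Sum>(j, k)\<in>F. inner_L2 M f (\<psi> j k) * \<phi> j k x)))
           \<longlongrightarrow> 0) (finite_subsets_at_top (Sigma UNIV I)))"


section \<open>Besov spaces\<close>

text \<open>In the exponent, \<open>enn2real (1 / p)\<close> is \<open>1/p\<close>, read as \<open>0\<close> for \<open>p = \<infinity>\<close>.\<close>

definition besov_norm ::
  "'a measure \<Rightarrow> real \<Rightarrow> (int \<Rightarrow> 'k set) \<Rightarrow> (int \<Rightarrow> 'k \<Rightarrow> 'a \<Rightarrow> complex) \<Rightarrow>
   real \<Rightarrow> ennreal \<Rightarrow> ennreal \<Rightarrow> ('a \<Rightarrow> complex) \<Rightarrow> ennreal"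
where
  "besov_norm M d I \<psi> s p q f =
     Lp_ennnorm (count_space UNIV) q
       (\<lambda>j. ennreal (2 powr (real_of_int j * (s + d * (1 / 2 - enn2real (1 / p)))))
            * lp_norm (I j) p (\<lambda>k. inner_L2 M f (\<psi> j k)))"

text \<open>
  The Bochner integral is \<open>0\<close> where it does not exist, so membership explicitly requires the
  coefficients to be defined.
\<close>

definition besov_space ::
  "'a measure \<Rightarrow> ('a \<Rightarrow> 'a \<Rightarrow> real) \<Rightarrow> real \<Rightarrow> (int \<Rightarrow> 'k set) \<Rightarrow> (int \<Rightarrow> 'k \<Rightarrow> 'a \<Rightarrow> complex) \<Rightarrow>
   real \<Rightarrow> ennreal \<Rightarrow> ennreal \<Rightarrow> ('a \<Rightarrow> complex) set"
where
  "besov_space M \<rho> d I \<psi> s p q =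
     {f \<in> L1_loc M \<rho>. (\<forall>j. \<forall>k\<in>I j. integrable M (\<lambda>x. f x * cnj (\<psi> j k x))) \<and>
                       besov_norm M d I \<psi> s p q f < \<infinity>}"

text \<open>The pointwise sum of the wavelet series, the continuous function with which an element of
  \<open>B\<^bsup>d/p\<^esup>\<^bsub>p,1\<^esub>\<close> is identified.\<close>

definition wavelet_sum ::
  "'a measure \<Rightarrow> (int \<Rightarrow> 'k set) \<Rightarrow> (int \<Rightarrow> 'k \<Rightarrow> 'a \<Rightarrow> complex) \<Rightarrow> (int \<Rightarrow> 'k \<Rightarrow> 'a \<Rightarrow> complex) \<Rightarrow>
   ('a \<Rightarrow> complex) \<Rightarrow> 'a \<Rightarrow> complex"
where
  "wavelet_sum M I \<phi> \<psi> f x = (\<Sum>\<^sub>\<infinity>j. \<Sum>\<^sub>\<infinity>k\<in>I j. inner_L2 M f (\<psi> j k) * \<phi> j k x)"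

end

theory Submission
  imports Defs
begin

text \<open>
  For \<open>p < \<infinity>\<close> the sampling set consists of the centers \<open>a\<^sub>k\<close> of the cubes \<open>Q\<^sub>k\<close> of one sufficiently fine
  generation \<open>N\<close>. These cubes have comparable volumes, so that the sum of \<open>|f(a\<^sub>k)|\<^sup>p\<close> is comparable,
  with constants depending on \<open>N\<close>, to the \<open>p\<close>-th power of the norm of the function that equals
  \<open>f(a\<^sub>k)\<close> on \<open>Q\<^sub>k\<close>. It remains to see that the oscillation of \<open>f\<close> on the cubes contributes only a
  small fraction of \<open>\<parallel>f\<parallel>\<^sub>p\<close>, which can then be absorbed.

  The oscillation is estimated separately for each generation \<open>j\<close> of the wavelet series. On a cube of
  generation \<open>N\<close> the wavelets of generation \<open>j\<close> vary by at most a multiple of \<open>2\<^bsup>jd/2\<^esup> min(1, 2\<^bsup>(j-N)\<theta>\<^esup>)\<close>, and only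
  boundedly many of them are nonzero at a given point (\<open>generation_oscillation\<close>). In \<open>\<ell>\<^sup>p\<close> over the cubes
  this gives (\<open>cube_error_power_sum_le\<close>), after normalization by the volume and for \<open>j \<le> N\<close>, the bound
  \<open>2\<^bsup>-jd/p\<^esup> min(1, 2\<^bsup>(j-N)\<theta>\<^esup>) b\<^sub>j\<close>, where the \<open>b\<^sub>j\<close> are the terms of the Besov norm, and the bound
  \<open>2\<^bsup>-Nd/p\<^esup> b\<^sub>j\<close> for larger \<open>j\<close>. For \<open>j \<ge> n\<close> the
  assumption \<open>\<Sum>b\<^sub>j \<le> K \<parallel>f\<parallel>\<^sub>p\<close> makes the total at most a multiple of \<open>2\<^bsup>-nd/p\<^esup> K \<parallel>f\<parallel>\<^sub>p\<close>. For
  low frequencies \<open>j < n\<close> the factor \<open>2\<^bsup>-jd/p\<^esup>\<close> is not bounded, but the decay of the dual wavelets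
  yields \<open>b\<^sub>j \<le> c 2\<^bsup>jd/p\<^esup> \<parallel>f\<parallel>\<^sub>p\<close> by Schur's test (\<open>coeff_power_sum_le\<close>), which compensates it, and the
  sum over \<open>j < n\<close> is at most a multiple of \<open>2\<^bsup>(n-N)\<theta>\<^esup> \<parallel>f\<parallel>\<^sub>p\<close>. With \<open>N = 2 n\<close> both contributions
  tend to \<open>0\<close> (\<open>total_error_le\<close>). The generations are added up by Minkowski's inequality.

  For \<open>p = \<infinity>\<close> there is no gain \<open>2\<^bsup>-nd/p\<^esup>\<close>, but the wavelet series converges uniformly, \<open>f\<close> is continuous,
  and the centers of all cubes form a countable dense set, on which the supremum of \<open>|f|\<close> is its
  essential supremum (\<open>esssup_eq_sup_centers\<close>). A space of diameter zero has at most one point and is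
  treated separately, because the point may then carry mass.

  All sums over indices are integrals with respect to the counting measure, so that the inequalities
  of Jensen and Minkowski and the interchange of sums and integrals are each stated once.
\<close>

section \<open>Powers and convexity inequalities in extended nonnegative numbers\<close>

lemma ennpow_ennreal: "0 \<le> x \<Longrightarrow> ennpow (ennreal x) a = ennreal (x powr a)"
  by (simp add: ennpow_def)

lemma ennpow_top [simp]: "ennpow top a = top"
  by (simp add: ennpow_def)

lemma ennpow_0 [simp]: "ennpow 0 a = 0"
  by (simp add: ennpow_def)

lemma ennpow_1: "ennpow t 1 = t"
  by (cases t) (auto simp: ennpow_ennreal)

lemma ennpow_finite: "t < top \<Longrightarrow> ennpow t a < top"
  by (simp add: ennpow_def)

lemma ennpow_mono:
  assumes "0 \<le> a" "s \<le> t" shows "ennpow s a \<le> ennpow t a"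
  using assms
  by (cases s; cases t) (auto simp: ennpow_ennreal top_unique intro!: ennreal_leI powr_mono2)

lemma ennpow_mult:
  assumes "0 < a" shows "ennpow (s * t) a = ennpow s a * ennpow t a"
proof (cases "s = top \<or> t = top")
  case True
  have "ennpow r a = 0 \<longleftrightarrow> r = 0" for r
    by (cases r) (auto simp: ennpow_ennreal ennreal_eq_0_iff)
  then show ?thesis using True by (metis ennpow_0 ennpow_top ennreal_mult_top ennreal_top_mult mult_zero_left mult_zero_right)
next
  case False
  then show ?thesis
    by (cases s; cases t) (auto simp: ennpow_ennreal powr_mult simp flip: ennreal_mult)
qed

lemma ennpow_inverse: "0 < a \<Longrightarrow> ennpow (ennpow t a) (1 / a) = t"
  by (cases t) (auto simp: ennpow_ennreal powr_powr)

lemma ennpow_inverse': "0 < a \<Longrightarrow> ennpow (ennpow t (1 / a)) a = t"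
  by (cases t) (auto simp: ennpow_ennreal powr_powr)

lemma ennpow_mult_self: "0 < t \<Longrightarrow> ennpow t (a - 1) * t = ennpow t a"
  by (cases t) (auto simp: ennpow_ennreal powr_diff simp flip: ennreal_mult)

lemma measurable_ennpow [measurable]:
  assumes [measurable]: "f \<in> borel_measurable M"
  shows "(\<lambda>x. ennpow (f x) a) \<in> borel_measurable M"
proof -
  have [measurable]: "{x \<in> space M. f x = \<infinity>} \<in> sets M"
    using assms by (intro borel_measurable_eq) auto
  have [measurable]: "(\<lambda>x. enn2real (f x) powr a) \<in> borel_measurable M"
    by (rule powr_real_measurable) auto
  show ?thesis unfolding ennpow_def by (intro measurable_If) auto
qed

text \<open>The sum is at most twice the larger summand; the constant is not optimal.\<close>

lemma ennpow_add_le: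
  assumes "0 < a"
  shows "ennpow (s + t) a \<le> ennreal (2 powr a) * (ennpow s a + ennpow t a)"
proof -
  have *: "ennpow (s + t) a \<le> ennreal (2 powr a) * (ennpow s a + ennpow t a)" if "s \<le> t" for s t
  proof -
    have "ennpow (s + t) a \<le> ennpow (2 * t) a"
      using assms that by (intro ennpow_mono) (auto simp: mult_2 add_mono)
    also have "\<dots> = ennreal (2 powr a) * ennpow t a"
      using ennpow_ennreal[of 2 a] assms by (simp add: ennpow_mult)
    also have "\<dots> \<le> ennreal (2 powr a) * (ennpow s a + ennpow t a)"
      by (intro mult_left_mono) auto
    finally show ?thesis .
  qed
  show ?thesis
  proof (cases "s \<le> t")
    case False then show ?thesis using *[of t s] by (simp add: add.commute)
  qed (rule *)
qed

lemma borel_measurable_nn_integral_count_space: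
  fixes f :: "'i \<Rightarrow> 'b \<Rightarrow> ennreal"
  assumes "countable I" and f: "\<And>i. i \<in> I \<Longrightarrow> f i \<in> borel_measurable N"
  shows "(\<lambda>x. \<integral>\<^sup>+i. f i x \<partial>count_space I) \<in> borel_measurable N"
proof -
  interpret sigma_finite_measure "count_space I"
    using assms(1) by (rule sigma_finite_measure_count_space_countable)
  have "case_prod (\<lambda>x i. f i x) \<in> borel_measurable (N \<Otimes>\<^sub>M count_space I)"
    using measurable_compose_countable'[where f="\<lambda>i z. f i (fst z)" and g=snd and I=I
      and M="N \<Otimes>\<^sub>M count_space I", OF _ _ assms(1)] f
    by (simp add: case_prod_beta' measurable_compose[OF measurable_fst])
  then show ?thesis by (rule borel_measurable_nn_integral)
qed

lemma powr_tangent_le: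
  fixes p m h :: real
  assumes "1 \<le> p" "0 \<le> m" "0 \<le> h"
  shows "p * m powr (p - 1) * h \<le> h powr p + (p - 1) * m powr p"
proof (cases "p = 1")
  case True
  then show ?thesis using assms by (cases "m = 0") auto
next
  case False
  define q where "q = p / (p - 1)"
  have p: "1 < p" using False assms by simp
  then have q: "1 < q" "1 / p + 1 / q = 1" by (auto simp: q_def field_simps)
  have "h * m powr (p - 1) \<le> h powr p / p + (m powr (p - 1)) powr q / q"
    by (rule Youngs_inequality) (use p q assms in auto)
  also have "(m powr (p - 1)) powr q = m powr p"
    using p by (simp add: powr_powr q_def)
  also have "h powr p / p + m powr p / q = (h powr p + (p - 1) * m powr p) / p"
    using p by (simp add: q_def field_simps)
  finally show ?thesis using p by (simp add: field_simps)
qed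

text \<open>Jensen's inequality for the convex function \<open>t \<mapsto> t\<^sup>p\<close> and a weight of finite total mass:
  the tangent line at the weighted mean is integrated against the weight.\<close>

lemma nn_integral_weighted_power_le:
  fixes h w :: "'b \<Rightarrow> ennreal"
  assumes p: "1 \<le> p"
    and [measurable]: "h \<in> borel_measurable N" "w \<in> borel_measurable N"
    and fin: "(\<integral>\<^sup>+x. w x \<partial>N) < \<infinity>"
  shows "ennpow (\<integral>\<^sup>+x. h x * w x \<partial>N) p
    \<le> ennpow (\<integral>\<^sup>+x. w x \<partial>N) (p - 1) * (\<integral>\<^sup>+x. ennpow (h x) p * w x \<partial>N)"
proof -
  obtain W where W: "0 \<le> W" "(\<integral>\<^sup>+x. w x \<partial>N) = ennreal W"
    using fin by (cases "\<integral>\<^sup>+x. w x \<partial>N") auto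
  show ?thesis
  proof (cases "W = 0")
    case True
    then have "AE x in N. w x = 0" using W by (simp add: nn_integral_0_iff_AE)
    then have "AE x in N. h x * w x = 0" by eventually_elim simp
    then have "(\<integral>\<^sup>+x. h x * w x \<partial>N) = 0"
      by (subst nn_integral_0_iff_AE) auto
    then show ?thesis by simp
  next
    case False
    then have W0: "0 < W" using W by simp
    show ?thesis
    proof (cases "(\<integral>\<^sup>+x. ennpow (h x) p * w x \<partial>N) = \<infinity>")
      case True
      then show ?thesis using W W0 by (simp add: ennpow_ennreal ennreal_mult_top)
    next
      case False
      then obtain S where S: "0 \<le> S" "(\<integral>\<^sup>+x. ennpow (h x) p * w x \<partial>N) = ennreal S"
        by (cases "\<integral>\<^sup>+x. ennpow (h x) p * w x \<partial>N") auto
      have tangent: "ennreal (p * m powr (p - 1)) * (\<integral>\<^sup>+x. h x * w x \<partial>N)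
          \<le> ennreal S + ennreal ((p - 1) * m powr p) * ennreal W" if m: "0 \<le> m" for m
      proof -
        have pw: "ennreal (p * m powr (p - 1)) * t \<le> ennpow t p + ennreal ((p - 1) * m powr p)"
          for t
        proof (cases t)
          case (real r)
          then show ?thesis
            using powr_tangent_le[OF p m, of r] p m
            by (simp add: ennpow_ennreal flip: ennreal_mult ennreal_plus)
        qed simp
        have "ennreal (p * m powr (p - 1)) * (\<integral>\<^sup>+x. h x * w x \<partial>N)
          = (\<integral>\<^sup>+x. (ennreal (p * m powr (p - 1)) * h x) * w x \<partial>N)"
          by (subst nn_integral_cmult[symmetric]) (auto simp: mult_ac)
        also have "\<dots> \<le> (\<integral>\<^sup>+x. (ennpow (h x) p + ennreal ((p - 1) * m powr p)) * w x \<partial>N)"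
          by (intro nn_integral_mono mult_right_mono pw) auto
        also have "\<dots> = ennreal S + ennreal ((p - 1) * m powr p) * ennreal W"
          by (simp add: distrib_right nn_integral_add nn_integral_cmult S W)
        finally show ?thesis .
      qed
      have "(\<integral>\<^sup>+x. h x * w x \<partial>N) < \<infinity>"
      proof -
        have "1 * (\<integral>\<^sup>+x. h x * w x \<partial>N) \<le> ennreal p * (\<integral>\<^sup>+x. h x * w x \<partial>N)"
          using p by (intro mult_right_mono) auto
        also have "\<dots> \<le> ennreal S + ennreal (p - 1) * ennreal W"
          using tangent[of 1] by simp
        also have "\<dots> < \<infinity>" by (simp add: ennreal_mult_less_top)
        finally show ?thesis by simp
      qed
      then obtain H where H: "0 \<le> H" "(\<integral>\<^sup>+x. h x * w x \<partial>N) = ennreal H"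
        by (cases "\<integral>\<^sup>+x. h x * w x \<partial>N") auto
      have "p * (H / W) powr (p - 1) * H \<le> S + (p - 1) * (H / W) powr p * W"
        using tangent[of "H / W"] S H W0 p
        by (simp flip: ennreal_mult ennreal_plus)
      moreover have "(H / W) powr (p - 1) * H = (H / W) powr p * W"
        using W0 H by (cases "H = 0") (auto simp: powr_diff field_simps)
      ultimately have "p * ((H / W) powr p * W) \<le> S + (p - 1) * ((H / W) powr p * W)"
        by (simp add: mult.assoc)
      then have "(H / W) powr p * W \<le> S" by (simp add: algebra_simps)
      moreover have "H powr p = W powr (p - 1) * ((H / W) powr p * W)"
        using W0 H by (simp add: powr_divide powr_diff)
      ultimately have "H powr p \<le> W powr (p - 1) * S" by (simp add: mult_left_mono)
      then show ?thesis using H S W by (simp add: ennpow_ennreal flip: ennreal_mult)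
    qed
  qed
qed

text \<open>Minkowski's inequality for countably many functions. It follows from Jensen's inequality with
  the bounds \<open>B i\<close> on the norms as the weights.\<close>

lemma nn_integral_Minkowski:
  fixes G :: "'i::countable \<Rightarrow> 'b \<Rightarrow> ennreal"
  assumes p: "1 \<le> p" and [measurable]: "\<And>i. G i \<in> borel_measurable N"
    and B: "\<And>i. (\<integral>\<^sup>+x. ennpow (G i x) p \<partial>N) \<le> ennpow (B i) p"
  shows "(\<integral>\<^sup>+x. ennpow (\<integral>\<^sup>+i. G i x \<partial>count_space UNIV) p \<partial>N)
    \<le> ennpow (\<integral>\<^sup>+i. B i \<partial>count_space UNIV) p"
proof -
  define S where "S = (\<integral>\<^sup>+i. B i \<partial>count_space UNIV)"
  have p0: "0 < p" using p by simp
  show ?thesis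
  proof (cases "S = \<infinity> \<or> S = 0")
    case True
    then show ?thesis
    proof
      assume "S = 0"
      then have B0: "B i = 0" for i
        by (auto simp: S_def nn_integral_0_iff_AE AE_count_space)
      have "AE x in N. G i x = 0" for i
      proof -
        have "AE x in N. ennpow (G i x) p = 0"
          using B[of i] B0[of i] by (subst nn_integral_0_iff_AE[symmetric]) auto
        then show ?thesis
          by eventually_elim (metis ennpow_0 ennpow_inverse p0)
      qed
      then have "AE x in N. \<forall>i. G i x = 0" by (simp add: AE_all_countable)
      then have "AE x in N. ennpow (\<integral>\<^sup>+i. G i x \<partial>count_space UNIV) p = 0"
        by eventually_elim simp
      then show ?thesis by (subst nn_integral_cong_AE[where v="\<lambda>_. 0"]) auto
    qed (simp add: S_def)
  next
    case False
    then have S: "S < \<infinity>" "0 < S" by (auto simp: less_top zero_less_iff_neq_zero)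
    have Bi: "B i < \<infinity>" for i
    proof -
      have "B i \<le> S" unfolding S_def by (rule nn_integral_ge_point) simp
      then show ?thesis using S by order
    qed
    have "AE x in N. \<forall>i. G i x = G i x / B i * B i"
      unfolding AE_all_countable
    proof
      fix i
      show "AE x in N. G i x = G i x / B i * B i"
      proof (cases "B i = 0")
        case True
        then have "AE x in N. ennpow (G i x) p = 0"
          using B[of i] by (subst nn_integral_0_iff_AE[symmetric]) auto
        then show ?thesis
          by eventually_elim (metis ennpow_0 ennpow_inverse p0 True mult_zero_right)
      next
        case False
        then show ?thesis
          using Bi[of i] mult_divide_eq_ennreal[of "B i"]
          by (intro AE_I2) (simp add: ennreal_times_divide less_top mult.commute[of _ "B i"])
      qed
    qed
    then have "(\<integral>\<^sup>+x. ennpow (\<integral>\<^sup>+i. G i x \<partial>count_space UNIV) p \<partial>N)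
      = (\<integral>\<^sup>+x. ennpow (\<integral>\<^sup>+i. G i x / B i * B i \<partial>count_space UNIV) p \<partial>N)"
      by (intro nn_integral_cong_AE) (auto elim!: eventually_mono intro!: arg_cong2[where f=ennpow] nn_integral_cong)
    also have "\<dots> \<le> (\<integral>\<^sup>+x. ennpow S (p - 1)
        * (\<integral>\<^sup>+i. ennpow (G i x / B i) p * B i \<partial>count_space UNIV) \<partial>N)"
      unfolding S_def using S
      by (intro nn_integral_mono nn_integral_weighted_power_le p) (auto simp: S_def)
    also have "\<dots> = ennpow S (p - 1)
        * (\<integral>\<^sup>+x. (\<integral>\<^sup>+i. ennpow (G i x / B i) p * B i \<partial>count_space UNIV) \<partial>N)"
      by (intro nn_integral_cmult borel_measurable_nn_integral_count_space) auto
    also have "(\<integral>\<^sup>+x. (\<integral>\<^sup>+i. ennpow (G i x / B i) p * B i \<partial>count_space UNIV) \<partial>N)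
      = (\<integral>\<^sup>+i. (\<integral>\<^sup>+x. ennpow (G i x / B i) p * B i \<partial>N) \<partial>count_space UNIV)"
      by (intro nn_integral_count_space_nn_integral) auto
    also have "\<dots> \<le> S"
      unfolding S_def
    proof (intro nn_integral_mono)
      fix i
      have "(\<integral>\<^sup>+x. ennpow (G i x / B i) p * B i \<partial>N)
        = (\<integral>\<^sup>+x. ennpow (G i x) p \<partial>N) * ennpow (inverse (B i)) p * B i"
        by (simp add: divide_ennreal_def ennpow_mult p0 nn_integral_multc)
      also have "\<dots> \<le> ennpow (B i) p * ennpow (inverse (B i)) p * B i"
        by (intro mult_right_mono B) auto
      also have "\<dots> = ennpow (B i * inverse (B i)) p * B i"
        by (simp add: ennpow_mult p0)
      also have "\<dots> \<le> B i"
      proof (cases "B i = 0")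
        case False
        then have "B i * inverse (B i) = 1"
          using Bi[of i] by (simp add: divide_ennreal_def[symmetric] ennreal_divide_self less_top)
        moreover have "ennpow 1 p = 1" using ennpow_ennreal[of 1 p] by simp
        ultimately show ?thesis by simp
      qed simp
      finally show "(\<integral>\<^sup>+x. ennpow (G i x / B i) p * B i \<partial>N) \<le> B i" .
    qed
    also have "ennpow S (p - 1) * S = ennpow S p" using S by (intro ennpow_mult_self)
    finally show ?thesis by (simp add: S_def mult_left_mono)
  qed
qed


section \<open>Geometry of a space with dyadic cubes\<close>

lemma le_suminf: "f m \<le> (\<Sum>n. f n)" for f :: "nat \<Rightarrow> ennreal"
  using sum_le_suminf[of f "{m}"] by simp

text \<open>Only growth of order \<open>R\<^sup>a\<close> of the sublevel sets matters, so that the estimate covers both the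
  integration of the decay of a wavelet and the summation over the centers of all cubes of one
  generation. The proof cuts the space at the dyadic values of \<open>1 + g\<close>.\<close>

lemma nn_integral_decay_le:
  fixes g :: "'b \<Rightarrow> real"
  assumes [measurable]: "g \<in> borel_measurable N"
    and g: "\<And>x. x \<in> space N \<Longrightarrow> 0 \<le> g x"
    and "0 < a" "0 < \<gamma>" "0 \<le> V"
    and vol: "\<And>R. 1 \<le> R \<Longrightarrow> emeasure N {x \<in> space N. g x < R} \<le> ennreal (V * R powr a)"
  shows "(\<integral>\<^sup>+x. ennreal ((1 + g x) powr (- (a + \<gamma>))) \<partial>N)
    \<le> ennreal (V * (2 powr a / (1 - 2 powr (- \<gamma>))))"
proof -
  define E where "E m = {x \<in> space N. g x < 2 powr (real m + 1)}" for m :: nat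
  have [measurable]: "E m \<in> sets N" for m unfolding E_def by measurable
  have pw: "ennreal ((1 + g x) powr (- (a + \<gamma>)))
      \<le> (\<Sum>m. ennreal (2 powr (- real m * (a + \<gamma>))) * indicator (E m) x)" if x: "x \<in> space N" for x
  proof -
    define t where "t = 1 + g x"
    have t: "1 \<le> t" using g[OF x] by (simp add: t_def)
    define m where "m = nat \<lfloor>log 2 t\<rfloor>"
    have m: "real m = of_int \<lfloor>log 2 t\<rfloor>" using t by (simp add: m_def)
    then have "real m \<le> log 2 t" "log 2 t < real m + 1" by linarith+
    then have lo: "2 powr real m \<le> t" and up: "t < 2 powr (real m + 1)"
      using t by (simp_all add: le_log_iff log_less_iff)
    have "t powr (- (a + \<gamma>)) \<le> (2 powr real m) powr (- (a + \<gamma>))"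
      using lo assms by (intro powr_mono2') auto
    also have "\<dots> = 2 powr (- real m * (a + \<gamma>))" by (simp add: powr_powr algebra_simps)
    finally have "ennreal (t powr (- (a + \<gamma>))) \<le> ennreal (2 powr (- real m * (a + \<gamma>)))"
      by (rule ennreal_leI)
    moreover have "x \<in> E m" using up x by (simp add: E_def t_def)
    ultimately have "ennreal (t powr (- (a + \<gamma>)))
        \<le> ennreal (2 powr (- real m * (a + \<gamma>))) * indicator (E m) x" by simp
    also have "\<dots> \<le> (\<Sum>m. ennreal (2 powr (- real m * (a + \<gamma>))) * indicator (E m) x)"
      by (rule le_suminf)
    finally show ?thesis by (simp add: t_def)
  qed
  define q where "q = 2 powr (- \<gamma>)"
  have q: "0 < q" "q < 1" using \<open>0 < \<gamma>\<close> by (auto simp: q_def powr_less_one)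
  have "(\<integral>\<^sup>+x. ennreal ((1 + g x) powr (- (a + \<gamma>))) \<partial>N)
      \<le> (\<integral>\<^sup>+x. (\<Sum>m. ennreal (2 powr (- real m * (a + \<gamma>))) * indicator (E m) x) \<partial>N)"
    by (intro nn_integral_mono pw)
  also have "\<dots> = (\<Sum>m. ennreal (2 powr (- real m * (a + \<gamma>))) * emeasure N (E m))"
    by (subst nn_integral_suminf) (simp_all add: nn_integral_cmult_indicator)
  also have "\<dots> \<le> (\<Sum>m. ennreal (V * 2 powr a * q ^ m))"
  proof (intro suminf_le)
    fix m :: nat
    have "ennreal (2 powr (- real m * (a + \<gamma>))) * emeasure N (E m)
        \<le> ennreal (2 powr (- real m * (a + \<gamma>))) * ennreal (V * (2 powr (real m + 1)) powr a)"
      unfolding E_def by (intro mult_left_mono vol ge_one_powr_ge_zero) auto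
    also have "\<dots> = ennreal (V * 2 powr a * q ^ m)"
    proof -
      have "2 powr (- real m * (a + \<gamma>)) * (2 powr (real m + 1)) powr a = 2 powr a * q ^ m"
        by (simp add: q_def powr_powr powr_realpow[symmetric] powr_add[symmetric] algebra_simps)
      then show ?thesis using \<open>0 \<le> V\<close> by (simp flip: ennreal_mult add: mult_ac)
    qed
    finally show "ennreal (2 powr (- real m * (a + \<gamma>))) * emeasure N (E m)
      \<le> ennreal (V * 2 powr a * q ^ m)" .
  qed auto
  also have "\<dots> = ennreal (V * 2 powr a * (1 / (1 - q)))"
    using q \<open>0 \<le> V\<close> by (intro suminf_ennreal_eq sums_mult geometric_sums) auto
  finally show ?thesis by (simp add: q_def)
qed

lemma rho_le_qdiam: "x \<in> X \<Longrightarrow> z \<in> X \<Longrightarrow> ereal (\<rho> x z) \<le> qdiam X \<rho>"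
  unfolding qdiam_def by (intro SUP_upper2[of x] SUP_upper2[of z]) auto

text \<open>The diameter is positive because the upper bound on the volume of balls, for all radii,
  excludes a single point of positive mass.\<close>

locale dyadic_space =
  fixes M :: "'a measure" and \<rho> :: "'a \<Rightarrow> 'a \<Rightarrow> real" and d :: real
    and I :: "int \<Rightarrow> 'k set" and Q :: "int \<Rightarrow> 'k \<Rightarrow> 'a set" and y :: "int \<Rightarrow> 'k \<Rightarrow> 'a"
    and A C r\<^sub>0 r\<^sub>1 :: real
  assumes rho_nonneg: "x \<in> space M \<Longrightarrow> z \<in> space M \<Longrightarrow> 0 \<le> \<rho> x z"
    and rho_sym: "x \<in> space M \<Longrightarrow> z \<in> space M \<Longrightarrow> \<rho> x z = \<rho> z x"
    and rho_triangle:
      "x \<in> space M \<Longrightarrow> z \<in> space M \<Longrightarrow> u \<in> space M \<Longrightarrow> \<rho> x z \<le> A * (\<rho> x u + \<rho> u z)"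
    and A_ge_1: "1 \<le> A" and d_pos: "0 < d" and C_pos: "0 < C"
    and r0_pos: "0 < r\<^sub>0" and r1_pos: "0 < r\<^sub>1"
    and diam_pos: "0 < qdiam (space M) \<rho>"
    and volume_lower: "0 < r \<Longrightarrow> ereal r < qdiam (space M) \<rho> \<Longrightarrow> x \<in> space M \<Longrightarrow>
      ennreal (r powr d / C) \<le> emeasure M (qball (space M) \<rho> x r)"
    and volume_upper: "0 < r \<Longrightarrow> x \<in> space M \<Longrightarrow>
      emeasure M (qball (space M) \<rho> x r) \<le> ennreal (C * r powr d)"
    and countable_I: "countable (I j)"
    and Q_sets: "k \<in> I j \<Longrightarrow> Q j k \<in> sets M"
    and Q_cover: "space M = (\<Union>k\<in>I j. Q j k)"
    and center: "k \<in> I j \<Longrightarrow> y j k \<in> Q j k"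
    and Q_inner: "k \<in> I j \<Longrightarrow> qball (space M) \<rho> (y j k) (r\<^sub>0 * 2 powr (- real_of_int j)) \<subseteq> Q j k"
    and Q_outer: "k \<in> I j \<Longrightarrow> Q j k \<subseteq> qball (space M) \<rho> (y j k) (r\<^sub>1 * 2 powr (- real_of_int j))"
    and Q_disjoint: "k \<in> I j \<Longrightarrow> l \<in> I j \<Longrightarrow> k \<noteq> l \<Longrightarrow> Q j k \<inter> Q j l = {}"
begin

lemma center_space: "k \<in> I j \<Longrightarrow> y j k \<in> space M"
  using center Q_sets sets.sets_into_space by blast

lemma in_cube_dist: "k \<in> I j \<Longrightarrow> x \<in> Q j k \<Longrightarrow> \<rho> x (y j k) < r\<^sub>1 * 2 powr (- real_of_int j)"
  using Q_outer[of k j] rho_sym[of x "y j k"] center_space[of k j] by (auto simp: qball_def)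

text \<open>A ball of positive measure is measurable, which covers the radii below the diameter.\<close>

lemma qball_sets [measurable]:
  assumes x: "x \<in> space M" shows "qball (space M) \<rho> x r \<in> sets M"
proof -
  have small: "qball (space M) \<rho> x s \<in> sets M" if "ereal s < qdiam (space M) \<rho>" for s
  proof (cases "0 < s")
    case True
    then have "0 < ennreal (s powr d / C)" using C_pos by simp
    then have "emeasure M (qball (space M) \<rho> x s) \<noteq> 0"
      using volume_lower[OF True that x] by force
    then show ?thesis using emeasure_notin_sets by blast
  next
    case False
    then have "qball (space M) \<rho> x s = {}" using rho_nonneg[OF x] by (force simp: qball_def)
    then show ?thesis by simp
  qed
  consider "ereal r < qdiam (space M) \<rho>" | "ereal r = qdiam (space M) \<rho>" | "qdiam (space M) \<rho> < ereal r"
    by fastforce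
  then show ?thesis
  proof cases
    case 2
    have "qball (space M) \<rho> x r = (\<Union>n. qball (space M) \<rho> x (r - 1 / real (Suc n)))"
    proof (intro set_eqI iffI)
      fix z assume z: "z \<in> qball (space M) \<rho> x r"
      then have "0 < r - \<rho> x z" by (simp add: qball_def)
      then obtain n where "inverse (real (Suc n)) < r - \<rho> x z" using reals_Archimedean by blast
      then have "z \<in> qball (space M) \<rho> x (r - 1 / real (Suc n))"
        using z by (simp add: qball_def inverse_eq_divide)
      then show "z \<in> (\<Union>n. qball (space M) \<rho> x (r - 1 / real (Suc n)))" by blast
    next
      fix z assume "z \<in> (\<Union>n. qball (space M) \<rho> x (r - 1 / real (Suc n)))"
      then obtain n where z: "z \<in> space M" and "\<rho> x z < r - 1 / real (Suc n)"
        by (auto simp: qball_def)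
      note this(2)
      also have "r - 1 / real (Suc n) < r" by simp
      finally show "z \<in> qball (space M) \<rho> x r" using z by (simp add: qball_def)
    qed
    also have "\<dots> \<in> sets M" by (intro sets.countable_UN image_subsetI small) (simp add: 2[symmetric])
    finally show ?thesis .
  next
    case 3
    have "\<rho> x z < r" if "z \<in> space M" for z
    proof -
      have "ereal (\<rho> x z) \<le> qdiam (space M) \<rho>" by (rule rho_le_qdiam[OF x that])
      then have "ereal (\<rho> x z) < ereal r" using 3 by (rule le_less_trans)
      then show ?thesis by simp
    qed
    then have "qball (space M) \<rho> x r = space M" by (auto simp: qball_def)
    then show ?thesis by simp
  qed (rule small)
qed

lemma rho_measurable: "x \<in> space M \<Longrightarrow> (\<lambda>z. \<rho> x z) \<in> borel_measurable M"
  using qball_sets[of x] by (simp add: borel_measurable_iff_less qball_def)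

lemma radius_exists: obtains D where "0 < D" "ereal D < qdiam (space M) \<rho>"
  using ereal_dense2[OF diam_pos] by auto

lemma cube_volume_upper:
  assumes "k \<in> I j"
  shows "emeasure M (Q j k) \<le> ennreal (C * (r\<^sub>1 * 2 powr (- real_of_int j)) powr d)"
proof -
  have "emeasure M (Q j k) \<le> emeasure M (qball (space M) \<rho> (y j k) (r\<^sub>1 * 2 powr (- real_of_int j)))"
    using Q_outer[OF assms] center_space[OF assms] by (intro emeasure_mono qball_sets)
  also have "\<dots> \<le> ennreal (C * (r\<^sub>1 * 2 powr (- real_of_int j)) powr d)"
    using center_space[OF assms] r1_pos by (intro volume_upper) auto
  finally show ?thesis .
qed

lemma cube_volume_lower:
  assumes k: "k \<in> I j" and s: "0 < s" "s \<le> r\<^sub>0 * 2 powr (- real_of_int j)"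
    "ereal s < qdiam (space M) \<rho>"
  shows "ennreal (s powr d / C) \<le> emeasure M (Q j k)"
proof -
  have "qball (space M) \<rho> (y j k) s \<subseteq> Q j k"
    using Q_inner[OF k] s by (force simp: qball_def)
  then have "emeasure M (qball (space M) \<rho> (y j k) s) \<le> emeasure M (Q j k)"
    using Q_sets[OF k] by (rule emeasure_mono)
  then show ?thesis using volume_lower[OF s(1,3) center_space[OF k]] by order
qed

lemma cube_volume_uniformly_pos:
  obtains m where "0 < m" "\<And>k. k \<in> I j \<Longrightarrow> ennreal m \<le> emeasure M (Q j k)"
proof -
  obtain D where D: "0 < D" "ereal D < qdiam (space M) \<rho>" by (rule radius_exists)
  define s where "s = min D (r\<^sub>0 * 2 powr (- real_of_int j))"
  have "ereal s < qdiam (space M) \<rho>" using D(2) by (rule le_less_trans[rotated]) (simp add: s_def)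
  then have "ennreal (s powr d / C) \<le> emeasure M (Q j k)" if "k \<in> I j" for k
    using that D r0_pos by (intro cube_volume_lower) (auto simp: s_def)
  moreover have "0 < s powr d / C"
  proof -
    have "0 < s" using D r0_pos by (simp add: s_def)
    then show ?thesis using C_pos by simp
  qed
  ultimately show ?thesis by (rule that[rotated])
qed

lemma ball_volume_pos:
  assumes "x \<in> space M" "0 < r" shows "0 < emeasure M (qball (space M) \<rho> x r)"
proof -
  obtain D where D: "0 < D" "ereal D < qdiam (space M) \<rho>" by (rule radius_exists)
  define s where "s = min D r"
  have "ereal s < qdiam (space M) \<rho>" using D(2) by (rule le_less_trans[rotated]) (simp add: s_def)
  moreover have "0 < s" using D assms by (simp add: s_def)
  ultimately have "ennreal (s powr d / C) \<le> emeasure M (qball (space M) \<rho> x s)"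
    using assms by (intro volume_lower) auto
  also have "\<dots> \<le> emeasure M (qball (space M) \<rho> x r)"
    by (intro emeasure_mono qball_sets assms) (auto simp: qball_def s_def)
  finally have "ennreal (s powr d / C) \<le> emeasure M (qball (space M) \<rho> x r)" .
  moreover have "0 < ennreal (s powr d / C)" using \<open>0 < s\<close> C_pos by simp
  ultimately show ?thesis by order
qed

definition overlap :: real where
  "overlap = max 1 (C * C * (2 * A * (1 + r\<^sub>1) / r\<^sub>0) powr d)"

lemma overlap_ge_1: "1 \<le> overlap"
  by (simp add: overlap_def)

text \<open>The cubes of one generation with center near \<open>x\<close> are disjoint, comparable in volume and
  contained in one larger ball. Generations so coarse that the inner ball of a cube is larger than
  the space consist of a single cube.\<close>

lemma count_centers_le:
  assumes x: "x \<in> space M" and R: "1 \<le> R"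
  shows "emeasure (count_space (I j)) {k \<in> I j. \<rho> x (y j k) < R * 2 powr (- real_of_int j)}
    \<le> ennreal (overlap * R powr d)"
proof -
  define \<delta> where "\<delta> = 2 powr (- real_of_int j)"
  have \<delta>: "0 < \<delta>" by (simp add: \<delta>_def)
  define K where "K = {k \<in> I j. \<rho> x (y j k) < R * \<delta>}"
  have K: "K \<subseteq> I j" "countable K"
    using countable_subset[OF _ countable_I[of j]] by (auto simp: K_def)
  have R_pos: "1 \<le> R powr d" using R d_pos by (simp add: ge_one_powr_ge_zero)
  have "emeasure (count_space (I j)) K \<le> ennreal (overlap * R powr d)"
  proof (cases "ereal (r\<^sub>0 / 2 * \<delta>) < qdiam (space M) \<rho>")
    case True
    define c where "c = (r\<^sub>0 / 2 * \<delta>) powr d / C"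
    have c: "0 < c" using r0_pos \<delta> C_pos by (simp add: c_def)
    define B where "B = C * (A * (R + r\<^sub>1) * \<delta>) powr d"
    have sub: "(\<Union>k\<in>K. Q j k) \<subseteq> qball (space M) \<rho> x (A * (R + r\<^sub>1) * \<delta>)"
    proof
      fix z assume "z \<in> (\<Union>k\<in>K. Q j k)"
      then obtain k where k: "k \<in> I j" "\<rho> x (y j k) < R * \<delta>" "z \<in> Q j k" by (auto simp: K_def)
      then have z: "z \<in> space M" using Q_sets sets.sets_into_space by blast
      have "\<rho> x z \<le> A * (\<rho> x (y j k) + \<rho> (y j k) z)"
        using x z k center_space by (intro rho_triangle) auto
      also have "\<dots> < A * (R * \<delta> + r\<^sub>1 * \<delta>)"
        using in_cube_dist[OF k(1,3)] k(2) A_ge_1 rho_sym[OF z center_space[OF k(1)]]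
        by (intro mult_strict_left_mono add_strict_mono) (auto simp: \<delta>_def)
      finally show "z \<in> qball (space M) \<rho> x (A * (R + r\<^sub>1) * \<delta>)"
        using z by (simp add: qball_def algebra_simps)
    qed
    have "ennreal c * emeasure (count_space (I j)) K = (\<integral>\<^sup>+k. ennreal c \<partial>count_space K)"
      using K by (simp add: emeasure_count_space)
    also have "\<dots> \<le> (\<integral>\<^sup>+k. emeasure M (Q j k) \<partial>count_space K)"
      unfolding c_def using K r0_pos \<delta> True
      by (intro nn_integral_mono cube_volume_lower) (auto simp: \<delta>_def)
    also have "\<dots> = emeasure M (\<Union>k\<in>K. Q j k)"
      using K Q_sets Q_disjoint
      by (intro emeasure_UN_countable[symmetric]) (auto simp: disjoint_family_on_def subset_eq)
    also have "\<dots> \<le> emeasure M (qball (space M) \<rho> x (A * (R + r\<^sub>1) * \<delta>))"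
      using x by (intro emeasure_mono sub qball_sets)
    also have "\<dots> \<le> ennreal B"
      unfolding B_def using x A_ge_1 R r1_pos \<delta> by (intro volume_upper) (auto intro!: mult_pos_pos)
    finally have le: "ennreal c * emeasure (count_space (I j)) K \<le> ennreal B" .
    have B: "0 \<le> B" using C_pos by (simp add: B_def)
    have "emeasure (count_space (I j)) K \<le> ennreal (B / c)"
    proof (cases "emeasure (count_space (I j)) K")
      case (real n)
      then have "c * n \<le> B" using le c B by (simp flip: ennreal_mult)
      then show ?thesis using real c by (simp add: field_simps ennreal_leI)
    next
      case top
      then show ?thesis using le c by (simp add: ennreal_mult_top top_unique)
    qed
    also have "B / c = C * C * (A * (R + r\<^sub>1) * \<delta> / (r\<^sub>0 / 2 * \<delta>)) powr d"
      using A_ge_1 R r1_pos \<delta> r0_pos C_pos by (subst powr_divide) (simp_all add: B_def c_def)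
    also have "A * (R + r\<^sub>1) * \<delta> / (r\<^sub>0 / 2 * \<delta>) = 2 * A * (R + r\<^sub>1) / r\<^sub>0"
      using \<delta> by simp
    also have "C * C * (2 * A * (R + r\<^sub>1) / r\<^sub>0) powr d
      \<le> C * C * ((2 * A * (1 + r\<^sub>1) / r\<^sub>0) * R) powr d"
    proof -
      have "r\<^sub>1 \<le> r\<^sub>1 * R" using r1_pos R by simp
      then have "2 * A * (R + r\<^sub>1) \<le> 2 * A * ((1 + r\<^sub>1) * R)"
        using A_ge_1 by (intro mult_left_mono) (auto simp: algebra_simps)
      then have "2 * A * (R + r\<^sub>1) / r\<^sub>0 \<le> (2 * A * (1 + r\<^sub>1) / r\<^sub>0) * R"
        using r0_pos by (simp add: divide_right_mono mult.assoc)
      then show ?thesis using A_ge_1 R r1_pos r0_pos d_pos C_pos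
        by (intro mult_left_mono powr_mono2) auto
    qed
    also have "\<dots> = C * C * (2 * A * (1 + r\<^sub>1) / r\<^sub>0) powr d * R powr d"
      using A_ge_1 R r1_pos r0_pos by (subst powr_mult) simp_all
    also have "\<dots> \<le> overlap * R powr d"
      by (intro mult_right_mono) (auto simp: overlap_def)
    finally show ?thesis by (simp add: ennreal_leI)
  next
    case False
    have all: "Q j k = space M" if k: "k \<in> I j" for k
    proof -
      have "\<rho> (y j k) z < r\<^sub>0 * \<delta>" if z: "z \<in> space M" for z
      proof -
        have "ereal (\<rho> (y j k) z) \<le> qdiam (space M) \<rho>"
          by (rule rho_le_qdiam[OF center_space[OF k] z])
        also have "\<dots> \<le> ereal (r\<^sub>0 / 2 * \<delta>)" using False by simp
        finally have "\<rho> (y j k) z \<le> r\<^sub>0 / 2 * \<delta>" by simp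
        also have "\<dots> < r\<^sub>0 * \<delta>" using r0_pos \<delta> by simp
        finally show ?thesis .
      qed
      then have "space M \<subseteq> Q j k" using Q_inner[OF k] by (auto simp: qball_def \<delta>_def)
      then show ?thesis using Q_sets[OF k] sets.sets_into_space by blast
    qed
    have "k = l" if "k \<in> K" "l \<in> K" for k l
      using Q_disjoint[of k j l] all[of k] all[of l] that x by (auto simp: K_def)
    then have "finite K \<and> card K \<le> 1"
      by (metis One_nat_def card.empty card_le_Suc0_iff_eq finite.emptyI finite.insertI
          is_singletonI' is_singleton_def zero_le)
    then have "emeasure (count_space (I j)) K \<le> ennreal 1"
      using K by (auto simp: emeasure_count_space ennreal_of_nat_eq_real_of_nat intro!: ennreal_leI)
    also have "\<dots> \<le> ennreal (overlap * R powr d)"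
      using mult_mono[OF overlap_ge_1 R_pos] overlap_ge_1 by (intro ennreal_leI) auto
    finally show ?thesis .
  qed
  then show ?thesis by (simp add: K_def \<delta>_def)
qed

lemma nn_integral_decay_space:
  assumes x: "x \<in> space M" and "0 < \<gamma>"
  shows "(\<integral>\<^sup>+z. ennreal ((1 + 2 powr real_of_int j * \<rho> x z) powr (- (d + \<gamma>))) \<partial>M)
    \<le> ennreal (C * 2 powr (- real_of_int j * d) * (2 powr d / (1 - 2 powr (- \<gamma>))))"
proof (rule nn_integral_decay_le)
  show "(\<lambda>z. 2 powr real_of_int j * \<rho> x z) \<in> borel_measurable M"
    using rho_measurable[OF x] by measurable
  fix R :: real assume R: "1 \<le> R"
  have "{z \<in> space M. 2 powr real_of_int j * \<rho> x z < R}
      = qball (space M) \<rho> x (R * 2 powr (- real_of_int j))"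
    by (auto simp: qball_def powr_minus field_simps)
  then show "emeasure M {z \<in> space M. 2 powr real_of_int j * \<rho> x z < R}
    \<le> ennreal (C * 2 powr (- real_of_int j * d) * R powr d)"
    using volume_upper[OF _ x, of "R * 2 powr (- real_of_int j)"] R
    by (simp add: powr_mult powr_powr mult_ac)
qed (use assms d_pos C_pos rho_nonneg[OF x] in auto)

lemma nn_integral_decay_centers:
  assumes x: "x \<in> space M" and "0 < \<gamma>"
  shows "(\<integral>\<^sup>+k. ennreal ((1 + 2 powr real_of_int j * \<rho> x (y j k)) powr (- (d + \<gamma>))) \<partial>count_space (I j))
    \<le> ennreal (overlap * (2 powr d / (1 - 2 powr (- \<gamma>))))"
proof (rule nn_integral_decay_le)
  fix R :: real assume R: "1 \<le> R"
  have "{k \<in> space (count_space (I j)). 2 powr real_of_int j * \<rho> x (y j k) < R}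
      = {k \<in> I j. \<rho> x (y j k) < R * 2 powr (- real_of_int j)}"
    by (auto simp: powr_minus field_simps)
  then show "emeasure (count_space (I j))
    {k \<in> space (count_space (I j)). 2 powr real_of_int j * \<rho> x (y j k) < R}
    \<le> ennreal (overlap * R powr d)"
    using count_centers_le[OF x R, of j] by simp
qed (use assms d_pos overlap_ge_1 rho_nonneg[OF x] center_space in auto)

end


section \<open>Sums over index sets and Lebesgue norms\<close>

lemma infsum_eq_integral_count_space:
  fixes f :: "'b \<Rightarrow> complex"
  assumes "(\<integral>\<^sup>+x. ennreal (norm (f x)) \<partial>count_space S) < \<infinity>"
  shows "integrable (count_space S) f" and "infsum f S = (LINT x|count_space S. f x)"
proof -
  show *: "integrable (count_space S) f" using assms by (simp add: integrable_iff_bounded)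
  then show "infsum f S = (LINT x|count_space S. f x)"
    using infsetsum_infsum[of f S] by (simp add: infsetsum_def abs_summable_on_def)
qed

text \<open>The iterated sums are unconditional and are \<open>0\<close> where they do not converge; absolute convergence
  identifies them with integrals, which are linear and bounded by the integral of the norm.\<close>

lemma norm_iterated_infsum_diff_le:
  fixes u v :: "'i \<Rightarrow> 'b \<Rightarrow> complex"
  assumes u: "(\<integral>\<^sup>+j. \<integral>\<^sup>+k. ennreal (norm (u j k)) \<partial>count_space (S j) \<partial>count_space UNIV) < \<infinity>"
    and v: "(\<integral>\<^sup>+j. \<integral>\<^sup>+k. ennreal (norm (v j k)) \<partial>count_space (S j) \<partial>count_space UNIV) < \<infinity>"
  shows "ennreal (norm ((\<Sum>\<^sub>\<infinity>j. \<Sum>\<^sub>\<infinity>k\<in>S j. u j k) - (\<Sum>\<^sub>\<infinity>j. \<Sum>\<^sub>\<infinity>k\<in>S j. v j k)))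
    \<le> (\<integral>\<^sup>+j. \<integral>\<^sup>+k. ennreal (norm (u j k - v j k)) \<partial>count_space (S j) \<partial>count_space UNIV)"
proof -
  define J where "J w j = (LINT k|count_space (S j). w j k)" for w :: "'i \<Rightarrow> 'b \<Rightarrow> complex" and j
  have inner: "integrable (count_space (S j)) (w j)" "infsum (w j) (S j) = J w j"
    and outer: "integrable (count_space UNIV) (J w)"
    and total: "(\<Sum>\<^sub>\<infinity>j. \<Sum>\<^sub>\<infinity>k\<in>S j. w j k) = (LINT j|count_space UNIV. J w j)"
    if w: "(\<integral>\<^sup>+j. \<integral>\<^sup>+k. ennreal (norm (w j k)) \<partial>count_space (S j) \<partial>count_space UNIV) < \<infinity>"
    for w :: "'i \<Rightarrow> 'b \<Rightarrow> complex" and j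
  proof -
    have fin: "(\<integral>\<^sup>+k. ennreal (norm (w j k)) \<partial>count_space (S j)) < \<infinity>" for j
      using nn_integral_ge_point[of j UNIV "\<lambda>j. \<integral>\<^sup>+k. ennreal (norm (w j k)) \<partial>count_space (S j)"] w
      by (simp add: order.strict_trans1)
    show int: "integrable (count_space (S j)) (w j)" for j
      by (rule infsum_eq_integral_count_space[OF fin])
    show eq: "infsum (w j) (S j) = J w j" for j
      unfolding J_def by (rule infsum_eq_integral_count_space[OF fin])
    have "(\<integral>\<^sup>+j. ennreal (norm (J w j)) \<partial>count_space UNIV)
      \<le> (\<integral>\<^sup>+j. \<integral>\<^sup>+k. ennreal (norm (w j k)) \<partial>count_space (S j) \<partial>count_space UNIV)"
      unfolding J_def by (intro nn_integral_mono integral_norm_bound_ennreal int)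
    also note w
    finally have fin': "(\<integral>\<^sup>+j. ennreal (norm (J w j)) \<partial>count_space UNIV) < \<infinity>" .
    show "integrable (count_space UNIV) (J w)"
      by (rule infsum_eq_integral_count_space[OF fin'])
    show "(\<Sum>\<^sub>\<infinity>j. \<Sum>\<^sub>\<infinity>k\<in>S j. w j k) = (LINT j|count_space UNIV. J w j)"
      unfolding eq by (rule infsum_eq_integral_count_space[OF fin'])
  qed
  have "(\<Sum>\<^sub>\<infinity>j. \<Sum>\<^sub>\<infinity>k\<in>S j. u j k) - (\<Sum>\<^sub>\<infinity>j. \<Sum>\<^sub>\<infinity>k\<in>S j. v j k)
      = (LINT j|count_space UNIV. J u j - J v j)"
    by (simp add: total[OF u] total[OF v] Bochner_Integration.integral_diff outer[OF u] outer[OF v])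
  also have "ennreal (norm \<dots>) \<le> (\<integral>\<^sup>+j. ennreal (norm (J u j - J v j)) \<partial>count_space UNIV)"
    by (intro integral_norm_bound_ennreal Bochner_Integration.integrable_diff outer u v)
  also have "\<dots> \<le> (\<integral>\<^sup>+j. \<integral>\<^sup>+k. ennreal (norm (u j k - v j k)) \<partial>count_space (S j) \<partial>count_space UNIV)"
  proof (intro nn_integral_mono)
    fix j
    have "J u j - J v j = (LINT k|count_space (S j). u j k - v j k)"
      unfolding J_def by (intro Bochner_Integration.integral_diff[symmetric] inner u v)
    then show "ennreal (norm (J u j - J v j))
        \<le> (\<integral>\<^sup>+k. ennreal (norm (u j k - v j k)) \<partial>count_space (S j))"
      using integral_norm_bound_ennreal[OF Bochner_Integration.integrable_diff[OF inner(1)[OF u] inner(1)[OF v]], of j]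
      by simp
  qed
  finally show ?thesis .
qed

lemma norm_le_lp_norm:
  assumes p: "1 \<le> p" and k: "k \<in> S"
  shows "ennreal (norm (c k)) \<le> lp_norm S p c"
proof (cases "p = \<infinity>")
  case True
  then show ?thesis
    using esssup_AE[of "\<lambda>k. ennreal (norm (c k))" "count_space S"] k
    by (simp add: Lp_norm_def Lp_ennnorm_def AE_count_space)
next
  case False
  define P where "P = enn2real p"
  have P: "0 < P"
    using p False by (cases p) (auto simp: P_def)
  have "ennreal (norm (c k)) = ennpow (ennpow (ennreal (norm (c k))) P) (1 / P)"
    by (simp add: ennpow_inverse P)
  also have "\<dots> \<le> ennpow (\<integral>\<^sup>+k. ennpow (ennreal (norm (c k))) P \<partial>count_space S) (1 / P)"
    using P k nn_integral_ge_point[of k S "\<lambda>k. ennpow (ennreal (norm (c k))) P"]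
    by (intro ennpow_mono) auto
  finally show ?thesis using False by (simp add: Lp_norm_def Lp_ennnorm_def P_def)
qed

text \<open>At the critical smoothness \<open>s = d/p\<close> the weight of generation \<open>j\<close> no longer depends on \<open>p\<close>.\<close>

lemma besov_norm_critical:
  "besov_norm M d I \<psi> (d * enn2real (1 / p)) p 1 f
    = (\<integral>\<^sup>+j. ennreal (2 powr (real_of_int j * d / 2)) * lp_norm (I j) p (\<lambda>k. inner_L2 M f (\<psi> j k))
        \<partial>count_space UNIV)"
  by (simp add: besov_norm_def Lp_ennnorm_def ennpow_1 algebra_simps)


section \<open>Wavelet series\<close>

locale wavelet_space = dyadic_space M \<rho> d I Q y A C r\<^sub>0 r\<^sub>1
  for M :: "'a measure" and \<rho> :: "'a \<Rightarrow> 'a \<Rightarrow> real" and d :: real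
    and I :: "int \<Rightarrow> 'k set" and Q :: "int \<Rightarrow> 'k \<Rightarrow> 'a set" and y :: "int \<Rightarrow> 'k \<Rightarrow> 'a"
    and A C r\<^sub>0 r\<^sub>1 :: real +
  fixes \<theta> L D \<gamma> :: real and \<phi> \<psi> :: "int \<Rightarrow> 'k \<Rightarrow> 'a \<Rightarrow> complex"
  assumes theta_pos: "0 < \<theta>" and L_pos: "0 < L" and D_pos: "0 < D" and gamma_pos: "0 < \<gamma>"
    and phi_support: "k \<in> I j \<Longrightarrow> x \<in> space M \<Longrightarrow>
      L * 2 powr (- real_of_int j) \<le> \<rho> x (y j k) \<Longrightarrow> \<phi> j k x = 0"
    and phi_bound: "k \<in> I j \<Longrightarrow> x \<in> space M \<Longrightarrow>
      norm (\<phi> j k x) \<le> L * 2 powr (real_of_int j * d / 2)"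
    and phi_Hoelder: "k \<in> I j \<Longrightarrow> x \<in> space M \<Longrightarrow> z \<in> space M \<Longrightarrow>
      norm (\<phi> j k x - \<phi> j k z) \<le> L * 2 powr (real_of_int j * (d / 2 + \<theta>)) * \<rho> x z powr \<theta>"
    and psi_decay: "k \<in> I j \<Longrightarrow> x \<in> space M \<Longrightarrow>
      norm (\<psi> j k x) \<le> D * 2 powr (real_of_int j * d / 2)
        * (1 + 2 powr real_of_int j * \<rho> x (y j k)) powr (- (d + \<gamma>))"
begin

abbreviation coeff :: "('a \<Rightarrow> complex) \<Rightarrow> int \<Rightarrow> 'k \<Rightarrow> complex" where
  "coeff f j k \<equiv> inner_L2 M f (\<psi> j k)"

definition decay_const :: real where
  "decay_const = 2 powr d / (1 - 2 powr (- \<gamma>))"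

lemma decay_const_pos: "0 < decay_const"
  using gamma_pos by (simp add: decay_const_def powr_less_one)

definition coeff_const :: "real \<Rightarrow> real" where
  "coeff_const P = D powr P * (C * decay_const) powr (P - 1) * (overlap * decay_const)"

lemma coeff_const_nonneg: "0 \<le> coeff_const P"
  using overlap_ge_1 decay_const_pos by (simp add: coeff_const_def)

text \<open>Schur's test: the dual wavelets of one generation, normalized by \<open>2\<^bsup>jd/2\<^esup>\<close>, form a kernel on
  \<open>X \<times> I j\<close> whose row sums are bounded and whose column integrals are of order \<open>2\<^bsup>-jd\<^esup>\<close>. This is
  what controls the low frequencies, on which the Besov norm has no grip.\<close>

lemma coeff_power_sum_le:
  assumes [measurable]: "f \<in> borel_measurable M" and P: "1 \<le> P"
  shows "(\<integral>\<^sup>+k. ennpow (ennreal (norm (coeff f j k))) P \<partial>count_space (I j))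
    \<le> ennreal (coeff_const P * 2 powr (real_of_int j * d * (1 - P / 2)))
      * (\<integral>\<^sup>+x. ennpow (ennreal (norm (f x))) P \<partial>M)"
proof -
  define w where "w k x = ennreal ((1 + 2 powr real_of_int j * \<rho> (y j k) x) powr (- (d + \<gamma>)))"
    for k x
  define a where "a = D * 2 powr (real_of_int j * d / 2)"
  define W where "W = C * 2 powr (- real_of_int j * d) * decay_const"
  have a: "0 < a" using D_pos by (simp add: a_def)
  have W: "0 < W" using C_pos decay_const_pos by (simp add: W_def)
  have w_meas [measurable]: "w k \<in> borel_measurable M" if "k \<in> I j" for k
    using rho_measurable[OF center_space[OF that]] unfolding w_def by measurable
  have column: "(\<integral>\<^sup>+x. w k x \<partial>M) \<le> ennreal W" if "k \<in> I j" for k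
    unfolding w_def W_def decay_const_def
    by (rule nn_integral_decay_space[OF center_space[OF that] gamma_pos])
  have row: "(\<integral>\<^sup>+k. w k x \<partial>count_space (I j)) \<le> ennreal (overlap * decay_const)"
    if x: "x \<in> space M" for x
  proof -
    have "(\<integral>\<^sup>+k. w k x \<partial>count_space (I j))
      = (\<integral>\<^sup>+k. ennreal ((1 + 2 powr real_of_int j * \<rho> x (y j k)) powr (- (d + \<gamma>))) \<partial>count_space (I j))"
      using rho_sym[OF x center_space] by (intro nn_integral_cong) (simp add: w_def)
    also have "\<dots> \<le> ennreal (overlap * decay_const)"
      unfolding decay_const_def by (rule nn_integral_decay_centers[OF x gamma_pos])
    finally show ?thesis .
  qed
  have coeff_le: "ennreal (norm (coeff f j k)) \<le> ennreal a * (\<integral>\<^sup>+x. ennreal (norm (f x)) * w k x \<partial>M)"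
    if k: "k \<in> I j" for k
  proof -
    have "ennreal (norm (coeff f j k)) \<le> (\<integral>\<^sup>+x. ennreal (norm (f x * cnj (\<psi> j k x))) \<partial>M)"
      unfolding inner_L2_def
      using integral_norm_bound_ennreal[of M "\<lambda>x. f x * cnj (\<psi> j k x)"]
        not_integrable_integral_eq[of M "\<lambda>x. f x * cnj (\<psi> j k x)"] by fastforce
    also have "\<dots> \<le> (\<integral>\<^sup>+x. ennreal a * (ennreal (norm (f x)) * w k x) \<partial>M)"
    proof (rule nn_integral_mono)
      fix x assume x: "x \<in> space M"
      have "norm (f x * cnj (\<psi> j k x)) \<le> norm (f x) * (a
          * (1 + 2 powr real_of_int j * \<rho> (y j k) x) powr (- (d + \<gamma>)))"
        using psi_decay[OF k x] rho_sym[OF x center_space[OF k]]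
        by (simp add: norm_mult a_def mult_left_mono)
      then show "ennreal (norm (f x * cnj (\<psi> j k x))) \<le> ennreal a * (ennreal (norm (f x)) * w k x)"
        using a by (simp add: w_def ennreal_leI mult_ac flip: ennreal_mult)
    qed
    also have "\<dots> = ennreal a * (\<integral>\<^sup>+x. ennreal (norm (f x)) * w k x \<partial>M)"
      using k by (intro nn_integral_cmult) measurable
    finally show ?thesis .
  qed
  have power_le: "ennpow (ennreal (norm (coeff f j k))) P
      \<le> ennreal (a powr P * W powr (P - 1)) * (\<integral>\<^sup>+x. ennpow (ennreal (norm (f x))) P * w k x \<partial>M)"
    if k: "k \<in> I j" for k
  proof -
    have "ennpow (ennreal (norm (coeff f j k))) P
        \<le> ennpow (ennreal a * (\<integral>\<^sup>+x. ennreal (norm (f x)) * w k x \<partial>M)) P"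
      using P by (intro ennpow_mono coeff_le k) auto
    also have "\<dots> = ennreal (a powr P) * ennpow (\<integral>\<^sup>+x. ennreal (norm (f x)) * w k x \<partial>M) P"
      using P a by (simp add: ennpow_mult ennpow_ennreal)
    also have "\<dots> \<le> ennreal (a powr P) * (ennpow (\<integral>\<^sup>+x. w k x \<partial>M) (P - 1)
        * (\<integral>\<^sup>+x. ennpow (ennreal (norm (f x))) P * w k x \<partial>M))"
      using P k le_less_trans[OF column[OF k], of \<infinity>]
      by (intro mult_left_mono nn_integral_weighted_power_le) auto
    also have "\<dots> \<le> ennreal (a powr P) * (ennpow (ennreal W) (P - 1)
        * (\<integral>\<^sup>+x. ennpow (ennreal (norm (f x))) P * w k x \<partial>M))"
      using P by (intro mult_left_mono mult_right_mono ennpow_mono column k) auto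
    finally show ?thesis using W by (simp add: ennpow_ennreal ennreal_mult mult.assoc)
  qed
  have "(\<integral>\<^sup>+k. ennpow (ennreal (norm (coeff f j k))) P \<partial>count_space (I j))
    \<le> (\<integral>\<^sup>+k. ennreal (a powr P * W powr (P - 1))
        * (\<integral>\<^sup>+x. ennpow (ennreal (norm (f x))) P * w k x \<partial>M) \<partial>count_space (I j))"
    by (intro nn_integral_mono power_le) simp
  also have "\<dots> = ennreal (a powr P * W powr (P - 1))
      * (\<integral>\<^sup>+k. \<integral>\<^sup>+x. ennpow (ennreal (norm (f x))) P * w k x \<partial>M \<partial>count_space (I j))"
    by (intro nn_integral_cmult) simp
  also have "(\<integral>\<^sup>+k. \<integral>\<^sup>+x. ennpow (ennreal (norm (f x))) P * w k x \<partial>M \<partial>count_space (I j))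
      = (\<integral>\<^sup>+x. \<integral>\<^sup>+k. ennpow (ennreal (norm (f x))) P * w k x \<partial>count_space (I j) \<partial>M)"
    by (rule nn_integral_count_space_nn_integral[symmetric]) (use countable_I in auto)
  also have "\<dots> = (\<integral>\<^sup>+x. ennpow (ennreal (norm (f x))) P * (\<integral>\<^sup>+k. w k x \<partial>count_space (I j)) \<partial>M)"
    by (intro nn_integral_cong nn_integral_cmult) simp
  also have "\<dots> \<le> (\<integral>\<^sup>+x. ennpow (ennreal (norm (f x))) P * ennreal (overlap * decay_const) \<partial>M)"
    by (intro nn_integral_mono mult_left_mono row) auto
  also have "\<dots> = (\<integral>\<^sup>+x. ennpow (ennreal (norm (f x))) P \<partial>M) * ennreal (overlap * decay_const)"
    by (intro nn_integral_multc) measurable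
  also have "ennreal (a powr P * W powr (P - 1))
      * ((\<integral>\<^sup>+x. ennpow (ennreal (norm (f x))) P \<partial>M) * ennreal (overlap * decay_const))
    = ennreal (coeff_const P * 2 powr (real_of_int j * d * (1 - P / 2)))
      * (\<integral>\<^sup>+x. ennpow (ennreal (norm (f x))) P \<partial>M)"
  proof -
    have "a powr P = D powr P * 2 powr (real_of_int j * d / 2 * P)"
      using D_pos by (simp add: a_def powr_mult powr_powr)
    moreover have "W powr (P - 1) = (C * decay_const) powr (P - 1) * 2 powr (- real_of_int j * d * (P - 1))"
      using C_pos decay_const_pos by (simp add: W_def powr_mult powr_powr)
    moreover have "2 powr (real_of_int j * d / 2 * P) * 2 powr (- real_of_int j * d * (P - 1))
        = 2 powr (real_of_int j * d * (1 - P / 2))"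
      by (simp add: powr_add[symmetric]) (simp add: algebra_simps)
    ultimately have "a powr P * W powr (P - 1) * (overlap * decay_const)
        = coeff_const P * 2 powr (real_of_int j * d * (1 - P / 2))"
      by (simp add: coeff_const_def mult_ac)
    moreover have "ennreal (a powr P * W powr (P - 1)) * ennreal (overlap * decay_const)
        = ennreal (a powr P * W powr (P - 1) * (overlap * decay_const))"
      using overlap_ge_1 decay_const_pos by (simp flip: ennreal_mult)
    ultimately have "ennreal (a powr P * W powr (P - 1)) * ennreal (overlap * decay_const)
        = ennreal (coeff_const P * 2 powr (real_of_int j * d * (1 - P / 2)))" by simp
    then show ?thesis by (simp only: mult_ac)
  qed
  finally show ?thesis by (simp add: mult_left_mono)
qed

definition near :: "int \<Rightarrow> 'a \<Rightarrow> 'k set" where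
  "near j x = {k \<in> I j. \<rho> x (y j k) < L * 2 powr (- real_of_int j)}"

definition multiplicity :: real where
  "multiplicity = overlap * (max 1 L) powr d"

lemma multiplicity_pos: "0 < multiplicity"
  using overlap_ge_1 by (simp add: multiplicity_def)

lemma near_subset: "near j x \<subseteq> I j"
  by (auto simp: near_def)

lemma phi_eq_0: "k \<in> I j \<Longrightarrow> x \<in> space M \<Longrightarrow> k \<notin> near j x \<Longrightarrow> \<phi> j k x = 0"
  using phi_support by (force simp: near_def)

lemma count_near_le:
  assumes "x \<in> space M"
  shows "emeasure (count_space (I j)) (near j x) \<le> ennreal multiplicity"
proof -
  have "near j x \<subseteq> {k \<in> I j. \<rho> x (y j k) < max 1 L * 2 powr (- real_of_int j)}"
    by (force simp: near_def intro: less_le_trans mult_right_mono)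
  then have "emeasure (count_space (I j)) (near j x)
      \<le> emeasure (count_space (I j)) {k \<in> I j. \<rho> x (y j k) < max 1 L * 2 powr (- real_of_int j)}"
    by (intro emeasure_mono) auto
  also have "\<dots> \<le> ennreal multiplicity"
    unfolding multiplicity_def by (rule count_centers_le[OF assms]) simp
  finally show ?thesis .
qed

text \<open>The constant \<open>2\<close> comes from the size of the wavelet and is the better bound when \<open>\<delta>\<close> exceeds the
  scale \<open>2\<^bsup>-j\<^esup>\<close>.\<close>

lemma phi_oscillation:
  assumes "k \<in> I j" "x \<in> space M" "z \<in> space M" "\<rho> x z \<le> \<delta>"
  shows "norm (\<phi> j k x - \<phi> j k z)
    \<le> L * 2 powr (real_of_int j * d / 2) * min 2 (2 powr (real_of_int j * \<theta>) * \<delta> powr \<theta>)"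
proof -
  have "norm (\<phi> j k x - \<phi> j k z) \<le> L * 2 powr (real_of_int j * d / 2) * 2"
    using norm_triangle_ineq4[of "\<phi> j k x" "\<phi> j k z"]
      phi_bound[OF assms(1,2)] phi_bound[OF assms(1,3)] by linarith
  moreover have "norm (\<phi> j k x - \<phi> j k z)
      \<le> L * 2 powr (real_of_int j * d / 2) * (2 powr (real_of_int j * \<theta>) * \<delta> powr \<theta>)"
  proof -
    have "norm (\<phi> j k x - \<phi> j k z) \<le> L * 2 powr (real_of_int j * (d / 2 + \<theta>)) * \<rho> x z powr \<theta>"
      using phi_Hoelder assms by blast
    also have "\<dots> \<le> L * 2 powr (real_of_int j * (d / 2 + \<theta>)) * \<delta> powr \<theta>"
      using assms theta_pos L_pos rho_nonneg by (intro mult_left_mono powr_mono2) auto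
    also have "2 powr (real_of_int j * (d / 2 + \<theta>))
        = 2 powr (real_of_int j * d / 2) * 2 powr (real_of_int j * \<theta>)"
      by (simp add: powr_add[symmetric] algebra_simps)
    finally show ?thesis by (simp add: mult_ac)
  qed
  ultimately show ?thesis using L_pos by (simp add: min_def)
qed

lemma generation_bound:
  assumes x: "x \<in> space M" and b: "\<And>k. k \<in> near j x \<Longrightarrow> ennreal (norm (c k)) \<le> b"
  shows "(\<integral>\<^sup>+k. ennreal (norm (c k * \<phi> j k x)) \<partial>count_space (I j))
    \<le> ennreal (multiplicity * L * 2 powr (real_of_int j * d / 2)) * b"
proof -
  have "(\<integral>\<^sup>+k. ennreal (norm (c k * \<phi> j k x)) \<partial>count_space (I j))
    \<le> (\<integral>\<^sup>+k. b * ennreal (L * 2 powr (real_of_int j * d / 2)) * indicator (near j x) k \<partial>count_space (I j))"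
  proof (rule nn_integral_mono)
    fix k assume k: "k \<in> space (count_space (I j))"
    show "ennreal (norm (c k * \<phi> j k x))
      \<le> b * ennreal (L * 2 powr (real_of_int j * d / 2)) * indicator (near j x) k"
    proof (cases "k \<in> near j x")
      case True
      then show ?thesis
        using k x by (simp add: norm_mult ennreal_mult mult_mono b ennreal_leI phi_bound)
    qed (use k x phi_eq_0 in auto)
  qed
  also have "\<dots> = b * ennreal (L * 2 powr (real_of_int j * d / 2)) * emeasure (count_space (I j)) (near j x)"
    using near_subset by (intro nn_integral_cmult_indicator) auto
  also have "\<dots> \<le> b * ennreal (L * 2 powr (real_of_int j * d / 2)) * ennreal multiplicity"
    by (intro mult_left_mono count_near_le x) auto
  also have "\<dots> = ennreal (multiplicity * L * 2 powr (real_of_int j * d / 2)) * b"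
    using multiplicity_pos L_pos by (simp add: ennreal_mult mult_ac)
  finally show ?thesis .
qed

lemma generation_oscillation:
  assumes x: "x \<in> space M" and z: "z \<in> space M" and \<delta>: "\<rho> x z \<le> \<delta>"
    and b: "\<And>k. k \<in> near j x \<union> near j z \<Longrightarrow> ennreal (norm (c k)) \<le> b"
  shows "(\<integral>\<^sup>+k. ennreal (norm (c k * \<phi> j k x - c k * \<phi> j k z)) \<partial>count_space (I j))
    \<le> ennreal (2 * multiplicity * L * 2 powr (real_of_int j * d / 2)
        * min 2 (2 powr (real_of_int j * \<theta>) * \<delta> powr \<theta>)) * b"
proof -
  define T where
    "T = L * 2 powr (real_of_int j * d / 2) * min 2 (2 powr (real_of_int j * \<theta>) * \<delta> powr \<theta>)"
  have T: "0 \<le> T" using L_pos by (simp add: T_def)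
  have "(\<integral>\<^sup>+k. ennreal (norm (c k * \<phi> j k x - c k * \<phi> j k z)) \<partial>count_space (I j))
    \<le> (\<integral>\<^sup>+k. b * ennreal T * indicator (near j x \<union> near j z) k \<partial>count_space (I j))"
  proof (rule nn_integral_mono)
    fix k assume k: "k \<in> space (count_space (I j))"
    show "ennreal (norm (c k * \<phi> j k x - c k * \<phi> j k z))
      \<le> b * ennreal T * indicator (near j x \<union> near j z) k"
    proof (cases "k \<in> near j x \<union> near j z")
      case True
      have "norm (\<phi> j k x - \<phi> j k z) \<le> T"
        unfolding T_def using k x z \<delta> by (intro phi_oscillation) auto
      then have "ennreal (norm (c k)) * ennreal (norm (\<phi> j k x - \<phi> j k z)) \<le> b * ennreal T"
        by (intro mult_mono b True ennreal_leI) auto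
      then show ?thesis
        using True by (simp add: norm_mult ennreal_mult right_diff_distrib[symmetric])
    qed (use k x z phi_eq_0 in auto)
  qed
  also have "\<dots> = b * ennreal T * emeasure (count_space (I j)) (near j x \<union> near j z)"
    using near_subset by (intro nn_integral_cmult_indicator) auto
  also have "\<dots> \<le> b * ennreal T * (ennreal multiplicity + ennreal multiplicity)"
    using near_subset
    by (intro mult_left_mono order_trans[OF emeasure_subadditive] add_mono count_near_le x z) auto
  also have "\<dots> = b * ennreal (T * (2 * multiplicity))"
    using multiplicity_pos T by (simp add: ennreal_mult mult.assoc flip: ennreal_plus)
  finally show ?thesis by (simp add: T_def mult_ac)
qed

definition besov_term :: "ennreal \<Rightarrow> ('a \<Rightarrow> complex) \<Rightarrow> int \<Rightarrow> ennreal" where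
  "besov_term p f j = ennreal (2 powr (real_of_int j * d / 2)) * lp_norm (I j) p (coeff f j)"

lemma besov_norm_eq:
  "besov_norm M d I \<psi> (d * enn2real (1 / p)) p 1 f = (\<integral>\<^sup>+j. besov_term p f j \<partial>count_space UNIV)"
  by (simp add: besov_norm_critical besov_term_def)

lemma wavelet_sum_diff_le:
  assumes p: "1 \<le> p" and fin: "(\<integral>\<^sup>+j. besov_term p f j \<partial>count_space UNIV) < \<infinity>"
    and x: "x \<in> space M" and z: "z \<in> space M"
  shows "ennreal (norm (wavelet_sum M I \<phi> \<psi> f x - wavelet_sum M I \<phi> \<psi> f z))
    \<le> (\<integral>\<^sup>+j. \<integral>\<^sup>+k. ennreal (norm (coeff f j k * \<phi> j k x - coeff f j k * \<phi> j k z))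
        \<partial>count_space (I j) \<partial>count_space UNIV)"
proof -
  have abs: "(\<integral>\<^sup>+j. \<integral>\<^sup>+k. ennreal (norm (coeff f j k * \<phi> j k x)) \<partial>count_space (I j)
      \<partial>count_space UNIV) < \<infinity>" if x: "x \<in> space M" for x
  proof -
    have "(\<integral>\<^sup>+j. \<integral>\<^sup>+k. ennreal (norm (coeff f j k * \<phi> j k x)) \<partial>count_space (I j) \<partial>count_space UNIV)
      \<le> (\<integral>\<^sup>+j. ennreal (multiplicity * L) * besov_term p f j \<partial>count_space UNIV)"
    proof (rule nn_integral_mono)
      fix j
      have "(\<integral>\<^sup>+k. ennreal (norm (coeff f j k * \<phi> j k x)) \<partial>count_space (I j))
        \<le> ennreal (multiplicity * L * 2 powr (real_of_int j * d / 2)) * lp_norm (I j) p (coeff f j)"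
        using near_subset by (intro generation_bound x norm_le_lp_norm p) auto
      then show "(\<integral>\<^sup>+k. ennreal (norm (coeff f j k * \<phi> j k x)) \<partial>count_space (I j))
        \<le> ennreal (multiplicity * L) * besov_term p f j"
        using multiplicity_pos L_pos by (simp add: besov_term_def ennreal_mult mult.assoc)
    qed
    also have "\<dots> < \<infinity>"
      using fin by (simp add: nn_integral_cmult ennreal_mult_less_top)
    finally show ?thesis .
  qed
  show ?thesis
    unfolding wavelet_sum_def by (rule norm_iterated_infsum_diff_le[OF abs[OF x] abs[OF z]])
qed

text \<open>Each generation is continuous, and the terms of the Besov norm dominate the generations
  uniformly, so dominated convergence over the generations applies.\<close>

lemma wavelet_sum_continuous:
  assumes p: "1 \<le> p" and fin: "(\<integral>\<^sup>+j. besov_term p f j \<partial>count_space UNIV) < \<infinity>"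
    and x: "\<And>n. x n \<in> space M" and z: "z \<in> space M" and lim: "(\<lambda>n. \<rho> (x n) z) \<longlonglongrightarrow> 0"
  shows "(\<lambda>n. wavelet_sum M I \<phi> \<psi> f (x n)) \<longlonglongrightarrow> wavelet_sum M I \<phi> \<psi> f z"
proof -
  define u where "u n j = ennreal (2 * multiplicity * L
    * min 2 (2 powr (real_of_int j * \<theta>) * \<rho> (x n) z powr \<theta>)) * besov_term p f j" for n j
  have le: "ennreal (norm (wavelet_sum M I \<phi> \<psi> f (x n) - wavelet_sum M I \<phi> \<psi> f z))
      \<le> (\<integral>\<^sup>+j. u n j \<partial>count_space UNIV)" for n
  proof (rule order_trans[OF wavelet_sum_diff_le[OF p fin x z] nn_integral_mono])
    fix j
    have "(\<integral>\<^sup>+k. ennreal (norm (coeff f j k * \<phi> j k (x n) - coeff f j k * \<phi> j k z)) \<partial>count_space (I j))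
      \<le> ennreal (2 * multiplicity * L * 2 powr (real_of_int j * d / 2)
        * min 2 (2 powr (real_of_int j * \<theta>) * \<rho> (x n) z powr \<theta>)) * lp_norm (I j) p (coeff f j)"
      using near_subset by (intro generation_oscillation x z norm_le_lp_norm p) auto
    also have "\<dots> = u n j"
      using multiplicity_pos L_pos by (simp add: u_def besov_term_def ennreal_mult mult_ac)
    finally show "(\<integral>\<^sup>+k. ennreal (norm (coeff f j k * \<phi> j k (x n) - coeff f j k * \<phi> j k z))
      \<partial>count_space (I j)) \<le> u n j" .
  qed
  have "(\<lambda>n. \<integral>\<^sup>+j. u n j \<partial>count_space UNIV) \<longlonglongrightarrow> (\<integral>\<^sup>+j. 0 \<partial>count_space (UNIV :: int set))"
  proof (rule nn_integral_dominated_convergence)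
    show "(\<integral>\<^sup>+j. ennreal (4 * multiplicity * L) * besov_term p f j \<partial>count_space UNIV) < \<infinity>"
      using fin by (simp add: nn_integral_cmult ennreal_mult_less_top)
    show "AE j in count_space UNIV. u n j \<le> ennreal (4 * multiplicity * L) * besov_term p f j" for n
      unfolding u_def using multiplicity_pos L_pos
      by (intro AE_I2 mult_right_mono ennreal_leI) auto
    show "AE j in count_space UNIV. (\<lambda>n. u n j) \<longlonglongrightarrow> 0"
    proof (intro AE_I2)
      fix j :: int
      have "besov_term p f j < \<infinity>"
        using nn_integral_ge_point[of j UNIV "besov_term p f"] fin by (simp add: order.strict_trans1)
      moreover have "(\<lambda>n. 2 * multiplicity * L
          * min 2 (2 powr (real_of_int j * \<theta>) * \<rho> (x n) z powr \<theta>))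
        \<longlonglongrightarrow> 2 * multiplicity * L * min 2 (2 powr (real_of_int j * \<theta>) * 0)"
        using theta_pos rho_nonneg x z
        by (intro tendsto_intros tendsto_zero_powrI[OF lim tendsto_const]) auto
      then have "(\<lambda>n. ennreal (2 * multiplicity * L
          * min 2 (2 powr (real_of_int j * \<theta>) * \<rho> (x n) z powr \<theta>))) \<longlonglongrightarrow> ennreal 0"
        by (intro tendsto_ennrealI) simp
      ultimately have "(\<lambda>n. u n j) \<longlonglongrightarrow> ennreal 0 * besov_term p f j"
        unfolding u_def by (intro tendsto_mult_ennreal tendsto_const) auto
      then show "(\<lambda>n. u n j) \<longlonglongrightarrow> 0" by simp
    qed
  qed auto
  then have "(\<lambda>n. \<integral>\<^sup>+j. u n j \<partial>count_space UNIV) \<longlonglongrightarrow> 0" by simp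
  then have "(\<lambda>n. ennreal (norm (wavelet_sum M I \<phi> \<psi> f (x n) - wavelet_sum M I \<phi> \<psi> f z))) \<longlonglongrightarrow> 0"
    by (rule tendsto_sandwich[OF _ _ tendsto_const, rotated 2]) (auto simp: le)
  then have "(\<lambda>n. norm (wavelet_sum M I \<phi> \<psi> f (x n) - wavelet_sum M I \<phi> \<psi> f z)) \<longlonglongrightarrow> 0"
    by (simp add: tendsto_ennreal_iff[where x=0, simplified])
  then show ?thesis by (rule LIM_zero_cancel[OF tendsto_norm_zero_cancel])
qed

text \<open>Balls have positive measure and the centers of all generations are dense, so for a continuous
  function both norms are the supremum over the whole space.\<close>

lemma esssup_eq_sup_centers:
  assumes p: "1 \<le> p" and fin: "(\<integral>\<^sup>+j. besov_term p f j \<partial>count_space UNIV) < \<infinity>"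
    and [measurable]: "f \<in> borel_measurable M"
    and eq: "\<And>x. x \<in> space M \<Longrightarrow> f x = wavelet_sum M I \<phi> \<psi> f x"
  shows "Lp_norm M \<infinity> f = lp_norm (\<Union>j. y j ` I j) \<infinity> f"
proof (rule antisym)
  let ?A = "\<Union>j. y j ` I j"
  have cont: "(\<lambda>n. ennreal (norm (f (x n)))) \<longlonglongrightarrow> ennreal (norm (f z))"
    if "\<And>n. x n \<in> space M" "z \<in> space M" "(\<lambda>n. \<rho> (x n) z) \<longlonglongrightarrow> 0" for x z
    using wavelet_sum_continuous[OF p fin that] that(1,2) by (auto intro!: tendsto_intros simp: eq)
  have "ennreal (norm (f z)) \<le> lp_norm ?A \<infinity> f" if z: "z \<in> space M" for z
  proof -
    have "\<exists>k. k \<in> I (int n) \<and> z \<in> Q (int n) k" for n using Q_cover[of "int n"] z by auto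
    then obtain k where k: "\<And>n. k n \<in> I (int n)" "\<And>n. z \<in> Q (int n) (k n)" by metis
    define x where "x n = y (int n) (k n)" for n
    have x: "x n \<in> space M" "x n \<in> ?A" for n using k center_space by (auto simp: x_def)
    have "(\<lambda>n. r\<^sub>1 * (1 / 2) ^ n) \<longlonglongrightarrow> r\<^sub>1 * 0"
      by (intro tendsto_intros LIMSEQ_power_zero) simp
    then have "(\<lambda>n. r\<^sub>1 * (1 / 2) ^ n) \<longlonglongrightarrow> 0" by simp
    moreover have "norm (\<rho> (x n) z) \<le> r\<^sub>1 * (1 / 2) ^ n" for n
    proof -
      have "\<rho> (x n) z \<le> r\<^sub>1 * 2 powr (- real n)"
        using in_cube_dist[OF k, of n] rho_sym[OF x(1) z, of n] by (simp add: x_def)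
      then show ?thesis
        using rho_nonneg[OF x(1) z, of n]
        by (simp add: powr_minus powr_realpow power_one_over inverse_eq_divide)
    qed
    ultimately have "(\<lambda>n. \<rho> (x n) z) \<longlonglongrightarrow> 0"
      by - (rule Lim_null_comparison[OF always_eventually], rule allI)
    then have "(\<lambda>n. ennreal (norm (f (x n)))) \<longlonglongrightarrow> ennreal (norm (f z))"
      by (rule cont[OF x(1) z])
    moreover have "ennreal (norm (f (x n))) \<le> lp_norm ?A \<infinity> f" for n
      by (rule norm_le_lp_norm[OF _ x(2)]) simp
    ultimately show ?thesis by (intro LIMSEQ_le_const2) blast+
  qed
  then show "Lp_norm M \<infinity> f \<le> lp_norm ?A \<infinity> f"
    unfolding Lp_norm_def[of M] Lp_ennnorm_def[of M] by (auto intro!: esssup_I)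
  have "ennreal (norm (f z)) \<le> Lp_norm M \<infinity> f" if z: "z \<in> space M" for z
  proof -
    define G where "G = {x \<in> space M. ennreal (norm (f x)) \<le> Lp_norm M \<infinity> f}"
    have G: "AE x in M. x \<in> G"
      using esssup_AE[of "\<lambda>x. ennreal (norm (f x))" M] AE_space
      by eventually_elim (simp add: G_def Lp_norm_def Lp_ennnorm_def)
    have "\<exists>x. x \<in> qball (space M) \<rho> z (inverse (real (Suc n))) \<and> x \<in> G" for n
    proof (rule ccontr)
      assume none: "\<not> ?thesis"
      have "AE x in M. x \<notin> qball (space M) \<rho> z (inverse (real (Suc n)))"
        using G by eventually_elim (use none in blast)
      then have "emeasure M (qball (space M) \<rho> z (inverse (real (Suc n)))) = 0"
        using qball_sets[OF z] by (subst (asm) AE_iff_measurable[OF _ refl]) (auto simp: qball_def)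
      then show False using ball_volume_pos[OF z, of "inverse (real (Suc n))"] by simp
    qed
    then obtain x where x: "\<And>n. x n \<in> qball (space M) \<rho> z (inverse (real (Suc n)))" "\<And>n. x n \<in> G"
      by metis
    have xM: "x n \<in> space M" for n using x(2) by (simp add: G_def)
    have "norm (\<rho> (x n) z) \<le> inverse (real (Suc n))" for n
      using x(1)[of n] rho_sym[OF xM z, of n] rho_nonneg[OF xM z, of n] by (simp add: qball_def)
    then have "(\<lambda>n. \<rho> (x n) z) \<longlonglongrightarrow> 0"
      by (intro Lim_null_comparison[OF always_eventually LIMSEQ_inverse_real_of_nat]) blast
    then have "(\<lambda>n. ennreal (norm (f (x n)))) \<longlonglongrightarrow> ennreal (norm (f z))"
      by (rule cont[OF xM z])
    moreover have "ennreal (norm (f (x n))) \<le> Lp_norm M \<infinity> f" for n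
      using x(2)[of n] by (simp add: G_def)
    ultimately show ?thesis by (intro LIMSEQ_le_const2) blast+
  qed
  then show "lp_norm ?A \<infinity> f \<le> Lp_norm M \<infinity> f"
    unfolding Lp_norm_def[of "count_space _"] Lp_ennnorm_def[of "count_space _"]
    using center_space by (auto intro!: esssup_I simp: AE_count_space)
qed

end


section \<open>Sampling at the centers of the cubes of one generation\<close>

lemma nn_integral_lessThan_geometric_int:
  assumes "0 < \<theta>"
  shows "(\<integral>\<^sup>+j. ennreal (2 powr (real_of_int j * \<theta>)) * indicator {..<int n} j \<partial>count_space UNIV)
    = ennreal (2 powr (real n * \<theta>) / (2 powr \<theta> - 1))"
proof -
  define q where "q = 2 powr (- \<theta>)"
  have q: "0 < q" "q < 1" using assms by (auto simp: q_def powr_less_one)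
  have "bij_betw (\<lambda>m. int n - 1 - int m) UNIV {..<int n}"
    by (rule bij_betwI[where g="\<lambda>j. nat (int n - 1 - j)"]) auto
  then have "(\<integral>\<^sup>+j. ennreal (2 powr (real_of_int j * \<theta>)) \<partial>count_space {..<int n})
      = (\<integral>\<^sup>+m. ennreal (2 powr (real_of_int (int n - 1 - int m) * \<theta>)) \<partial>count_space UNIV)"
    by (rule nn_integral_bij_count_space[symmetric])
  also have "\<dots> = (\<Sum>m. ennreal (2 powr (real n * \<theta>) * q * q ^ m))"
    by (subst nn_integral_count_space_nat, intro suminf_cong arg_cong[where f=ennreal])
      (simp add: q_def powr_powr powr_realpow[symmetric] powr_add[symmetric] algebra_simps)
  also have "\<dots> = ennreal (2 powr (real n * \<theta>) * q * (1 / (1 - q)))"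
    using q by (intro suminf_ennreal_eq sums_mult geometric_sums) auto
  also have "2 powr (real n * \<theta>) * q * (1 / (1 - q)) = 2 powr (real n * \<theta>) / (2 powr \<theta> - 1)"
  proof -
    have "q * (1 / (1 - q)) = 1 / (2 powr \<theta> - 1)"
      using q by (simp add: q_def powr_minus field_simps)
    then show ?thesis by (simp only: mult.assoc) simp
  qed
  finally show ?thesis by (simp add: nn_integral_count_space_indicator)
qed

lemma Lp_norm_ennreal:
  "0 \<le> P \<Longrightarrow> Lp_norm N (ennreal P) f = ennpow (\<integral>\<^sup>+x. ennpow (ennreal (norm (f x))) P \<partial>N) (1 / P)"
  by (simp add: Lp_norm_def Lp_ennnorm_def)

lemma ennpow_Lp_norm:
  "0 < P \<Longrightarrow> ennpow (Lp_norm N (ennreal P) f) P = (\<integral>\<^sup>+x. ennpow (ennreal (norm (f x))) P \<partial>N)"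
  by (simp add: Lp_norm_ennreal ennpow_inverse')

context wavelet_space
begin

lemma center_inj: "inj_on (y j) (I j)"
proof (rule inj_onI)
  fix k l assume "k \<in> I j" "l \<in> I j" "y j k = y j l"
  then show "k = l" using center[of k j] center[of l j] Q_disjoint[of k j l] by auto
qed

lemma nn_integral_cubes:
  assumes [measurable]: "g \<in> borel_measurable M"
  shows "(\<integral>\<^sup>+k. \<integral>\<^sup>+x. g x * indicator (Q j k) x \<partial>M \<partial>count_space (I j)) = (\<integral>\<^sup>+x. g x \<partial>M)"
proof -
  have [measurable]: "Q j k \<in> sets M" if "k \<in> I j" for k using Q_sets that by blast
  have "(\<integral>\<^sup>+k. \<integral>\<^sup>+x. g x * indicator (Q j k) x \<partial>M \<partial>count_space (I j))
      = (\<integral>\<^sup>+x. \<integral>\<^sup>+k. g x * indicator (Q j k) x \<partial>count_space (I j) \<partial>M)"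
    by (rule nn_integral_count_space_nn_integral[symmetric]) (use countable_I in auto)
  also have "\<dots> = (\<integral>\<^sup>+x. g x \<partial>M)"
  proof (rule nn_integral_cong)
    fix x assume "x \<in> space M"
    then obtain l where l: "l \<in> I j" "x \<in> Q j l" using Q_cover by blast
    have "(\<integral>\<^sup>+k. g x * indicator (Q j k) x \<partial>count_space (I j))
        = (\<integral>\<^sup>+k. g x * indicator {l} k \<partial>count_space (I j))"
      using l Q_disjoint[of _ j l] by (intro nn_integral_cong) (auto split: split_indicator)
    then show "(\<integral>\<^sup>+k. g x * indicator (Q j k) x \<partial>count_space (I j)) = g x"
      using l by (simp add: nn_integral_cmult_indicator)
  qed
  finally show ?thesis .
qed

text \<open>The window contains the centers of all wavelets of generation \<open>j\<close> that do not vanish somewhere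
  on the cube \<open>Q N k\<close>.\<close>

definition window_radius :: real where
  "window_radius = A * (r\<^sub>1 + L)"

definition window :: "int \<Rightarrow> int \<Rightarrow> 'k \<Rightarrow> 'k set" where
  "window j N k = {l \<in> I j. \<rho> (y N k) (y j l)
     < window_radius * max (2 powr (- real_of_int j)) (2 powr (- real_of_int N))}"

definition osc :: "int \<Rightarrow> int \<Rightarrow> real" where
  "osc j N = min 2 (2 powr (real_of_int j * \<theta>) * (r\<^sub>1 * 2 powr (- real_of_int N)) powr \<theta>)"

text \<open>On a cube, at most a bounded number of wavelets of generation \<open>j\<close> matters at each of two points,
  so the \<open>\<ell>\<^sup>p\<close> norm of the coefficients in the window suffices in place of their sum. This keeps the bound
  sharp for \<open>j > N\<close>, where the window contains many centers.\<close>

definition cube_error :: "real \<Rightarrow> ('a \<Rightarrow> complex) \<Rightarrow> int \<Rightarrow> int \<Rightarrow> 'k \<Rightarrow> ennreal" where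
  "cube_error P f j N k = ennreal (2 * multiplicity * L * 2 powr (real_of_int j * d / 2) * osc j N)
     * ennpow (\<integral>\<^sup>+l. ennpow (ennreal (norm (coeff f j l))) P * indicator (window j N k) l
         \<partial>count_space (I j)) (1 / P)"

lemma osc_nonneg: "0 \<le> osc j N"
  by (simp add: osc_def)

lemma near_subset_window:
  assumes k: "k \<in> I N" and x: "x \<in> Q N k"
  shows "near j x \<subseteq> window j N k"
proof
  fix l assume l: "l \<in> near j x"
  define m where "m = max (2 powr (- real_of_int j)) (2 powr (- real_of_int N))"
  have l': "l \<in> I j" "\<rho> x (y j l) < L * 2 powr (- real_of_int j)" using l by (auto simp: near_def)
  have xM: "x \<in> space M" using x Q_sets[OF k] sets.sets_into_space by blast
  have "\<rho> (y N k) (y j l) \<le> A * (\<rho> (y N k) x + \<rho> x (y j l))"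
    using xM k l' center_space by (intro rho_triangle) auto
  also have "\<dots> < A * (r\<^sub>1 * 2 powr (- real_of_int N) + L * 2 powr (- real_of_int j))"
    using in_cube_dist[OF k x] l'(2) A_ge_1 rho_sym[OF xM center_space[OF k]]
    by (intro mult_strict_left_mono add_strict_mono) auto
  also have "\<dots> \<le> A * (r\<^sub>1 * m + L * m)"
    using A_ge_1 r1_pos L_pos by (intro mult_left_mono add_mono) (auto simp: m_def)
  also have "\<dots> = window_radius * m" by (simp add: window_radius_def algebra_simps)
  finally show "l \<in> window j N k" using l'(1) by (simp add: window_def m_def)
qed

lemma cube_oscillation:
  assumes P: "1 \<le> P"
    and fin: "(\<integral>\<^sup>+j. besov_term (ennreal P) f j \<partial>count_space UNIV) < \<infinity>"
    and k: "k \<in> I N" and x: "x \<in> Q N k"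
  shows "ennreal (norm (wavelet_sum M I \<phi> \<psi> f x - wavelet_sum M I \<phi> \<psi> f (y N k)))
    \<le> (\<integral>\<^sup>+j. cube_error P f j N k \<partial>count_space UNIV)"
proof -
  have xM: "x \<in> space M" using x Q_sets[OF k] sets.sets_into_space by blast
  have p: "1 \<le> ennreal P" using P by simp
  show ?thesis
  proof (rule order_trans[OF wavelet_sum_diff_le[OF p fin xM center_space[OF k]] nn_integral_mono])
    fix j
    define b where "b = ennpow (\<integral>\<^sup>+l. ennpow (ennreal (norm (coeff f j l))) P
      * indicator (window j N k) l \<partial>count_space (I j)) (1 / P)"
    have b: "ennreal (norm (coeff f j l)) \<le> b" if "l \<in> near j x \<union> near j (y N k)" for l
    proof -
      have l: "l \<in> window j N k"
        using that near_subset_window[OF k x] near_subset_window[OF k center[OF k]] by blast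
      then have "l \<in> I j" by (simp add: window_def)
      have "ennreal (norm (coeff f j l)) = ennpow (ennpow (ennreal (norm (coeff f j l))) P) (1 / P)"
        using P by (simp add: ennpow_inverse)
      also have "\<dots> \<le> b"
        unfolding b_def
        using P l nn_integral_ge_point[OF \<open>l \<in> I j\<close>,
            of "\<lambda>l. ennpow (ennreal (norm (coeff f j l))) P * indicator (window j N k) l"]
        by (intro ennpow_mono) auto
      finally show ?thesis .
    qed
    have "(\<integral>\<^sup>+l. ennreal (norm (coeff f j l * \<phi> j l x - coeff f j l * \<phi> j l (y N k))) \<partial>count_space (I j))
      \<le> ennreal (2 * multiplicity * L * 2 powr (real_of_int j * d / 2)
        * min 2 (2 powr (real_of_int j * \<theta>) * (r\<^sub>1 * 2 powr (- real_of_int N)) powr \<theta>)) * b"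
      using in_cube_dist[OF k x] by (intro generation_oscillation b xM center_space k) auto
    then show "(\<integral>\<^sup>+l. ennreal (norm (coeff f j l * \<phi> j l x - coeff f j l * \<phi> j l (y N k)))
        \<partial>count_space (I j)) \<le> cube_error P f j N k"
      by (simp add: cube_error_def osc_def b_def)
  qed
qed

definition error_const :: "real \<Rightarrow> real" where
  "error_const P = 2 * multiplicity * L * (overlap * max 1 window_radius powr d) powr (1 / P)"

lemma error_const_nonneg: "0 \<le> error_const P"
  using multiplicity_pos L_pos by (simp add: error_const_def)

text \<open>Each coefficient of generation \<open>j\<close> is seen from at most a multiple of \<open>max 1 (2\<^bsup>N-j\<^esup>)\<^sup>d\<close> cubes
  of generation \<open>N\<close>.\<close>

lemma cube_error_power_sum_le:
  assumes P: "1 \<le> P"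
  shows "(\<integral>\<^sup>+k. ennpow (cube_error P f j N k) P \<partial>count_space (I N))
    \<le> ennpow (ennreal (error_const P * osc j N * max 1 (2 powr (real_of_int N - real_of_int j)) powr (d / P))
        * besov_term (ennreal P) f j) P"
proof -
  define a where "a = 2 * multiplicity * L * 2 powr (real_of_int j * d / 2) * osc j N"
  have a: "0 \<le> a" using multiplicity_pos L_pos osc_nonneg by (simp add: a_def)
  define R where "R = max 1 window_radius * max 1 (2 powr (real_of_int N - real_of_int j))"
  have R: "1 \<le> R" by (simp add: R_def) (metis max.cobounded1 mult_mono' mult_1 zero_le_one)
  have R0: "0 \<le> overlap * R powr d" using overlap_ge_1 by simp
  have count: "emeasure (count_space (I N)) {k \<in> I N. l \<in> window j N k} \<le> ennreal (overlap * R powr d)"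
    if l: "l \<in> I j" for l
  proof -
    have "window_radius * max (2 powr (- real_of_int j)) (2 powr (- real_of_int N))
        \<le> R * 2 powr (- real_of_int N)"
    proof -
      have "max (2 powr (- real_of_int j)) (2 powr (- real_of_int N))
          = max 1 (2 powr (real_of_int N - real_of_int j)) * 2 powr (- real_of_int N)"
        by (simp add: max_mult_distrib_right powr_add[symmetric] max.commute)
      then show ?thesis
        by (simp add: R_def mult.assoc mult_right_mono)
    qed
    then have "{k \<in> I N. l \<in> window j N k} \<subseteq> {k \<in> I N. \<rho> (y j l) (y N k) < R * 2 powr (- real_of_int N)}"
      using l rho_sym[OF center_space[OF l] center_space[of _ N]] by (auto simp: window_def)
    then have "emeasure (count_space (I N)) {k \<in> I N. l \<in> window j N k}
        \<le> emeasure (count_space (I N)) {k \<in> I N. \<rho> (y j l) (y N k) < R * 2 powr (- real_of_int N)}"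
      by (intro emeasure_mono) auto
    also have "\<dots> \<le> ennreal (overlap * R powr d)"
      by (rule count_centers_le[OF center_space[OF l] R])
    finally show ?thesis .
  qed
  have "(\<integral>\<^sup>+k. ennpow (cube_error P f j N k) P \<partial>count_space (I N))
    = (\<integral>\<^sup>+k. ennreal (a powr P) * (\<integral>\<^sup>+l. ennpow (ennreal (norm (coeff f j l))) P
        * indicator (window j N k) l \<partial>count_space (I j)) \<partial>count_space (I N))"
    using P a by (simp add: cube_error_def a_def[symmetric] ennpow_mult ennpow_ennreal ennpow_inverse')
  also have "\<dots> = ennreal (a powr P) * (\<integral>\<^sup>+k. \<integral>\<^sup>+l. ennpow (ennreal (norm (coeff f j l))) P
        * indicator (window j N k) l \<partial>count_space (I j) \<partial>count_space (I N))"
    by (rule nn_integral_cmult) simp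
  also have "(\<integral>\<^sup>+k. \<integral>\<^sup>+l. ennpow (ennreal (norm (coeff f j l))) P
        * indicator (window j N k) l \<partial>count_space (I j) \<partial>count_space (I N))
    = (\<integral>\<^sup>+l. \<integral>\<^sup>+k. ennpow (ennreal (norm (coeff f j l))) P
        * indicator (window j N k) l \<partial>count_space (I N) \<partial>count_space (I j))"
    by (rule nn_integral_count_space_nn_integral[OF countable_I]) simp
  also have "\<dots> = (\<integral>\<^sup>+l. \<integral>\<^sup>+k. ennpow (ennreal (norm (coeff f j l))) P
        * indicator {k \<in> I N. l \<in> window j N k} k \<partial>count_space (I N) \<partial>count_space (I j))"
    by (intro nn_integral_cong) (auto split: split_indicator)
  also have "\<dots> = (\<integral>\<^sup>+l. ennpow (ennreal (norm (coeff f j l))) P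
        * emeasure (count_space (I N)) {k \<in> I N. l \<in> window j N k} \<partial>count_space (I j))"
    by (intro nn_integral_cong nn_integral_cmult_indicator) auto
  also have "\<dots> \<le> (\<integral>\<^sup>+l. ennpow (ennreal (norm (coeff f j l))) P * ennreal (overlap * R powr d) \<partial>count_space (I j))"
    by (intro nn_integral_mono mult_left_mono count) auto
  also have "\<dots> = (\<integral>\<^sup>+l. ennpow (ennreal (norm (coeff f j l))) P \<partial>count_space (I j)) * ennreal (overlap * R powr d)"
    by (rule nn_integral_multc) simp
  also have "\<dots> = ennpow (lp_norm (I j) (ennreal P) (coeff f j)) P * ennreal (overlap * R powr d)"
    using P by (simp add: ennpow_Lp_norm)
  also have "ennreal (overlap * R powr d) = ennpow (ennreal ((overlap * R powr d) powr (1 / P))) P"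
    using P R0 by (simp add: ennpow_ennreal powr_powr)
  also have "ennreal (a powr P) = ennpow (ennreal a) P"
    using a by (simp add: ennpow_ennreal)
  finally have "(\<integral>\<^sup>+k. ennpow (cube_error P f j N k) P \<partial>count_space (I N))
    \<le> ennpow (ennreal a * (lp_norm (I j) (ennreal P) (coeff f j)
        * ennreal ((overlap * R powr d) powr (1 / P)))) P"
    using P by (simp add: ennpow_mult mult_left_mono)
  also have "ennreal a * (lp_norm (I j) (ennreal P) (coeff f j) * ennreal ((overlap * R powr d) powr (1 / P)))
    = ennreal (error_const P * osc j N * max 1 (2 powr (real_of_int N - real_of_int j)) powr (d / P))
        * besov_term (ennreal P) f j"
  proof -
    have "R powr d = max 1 window_radius powr d * max 1 (2 powr (real_of_int N - real_of_int j)) powr d"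
      unfolding R_def by (rule powr_mult)
    then have "(overlap * R powr d) powr (1 / P)
      = (overlap * max 1 window_radius powr d) powr (1 / P)
        * max 1 (2 powr (real_of_int N - real_of_int j)) powr (d / P)"
      using overlap_ge_1 by (simp add: powr_mult powr_powr mult.assoc[symmetric])
    then have "a * (overlap * R powr d) powr (1 / P)
      = error_const P * osc j N * max 1 (2 powr (real_of_int N - real_of_int j)) powr (d / P)
        * 2 powr (real_of_int j * d / 2)"
      by (simp add: a_def error_const_def mult_ac)
    then have "ennreal a * ennreal ((overlap * R powr d) powr (1 / P))
      = ennreal (error_const P * osc j N * max 1 (2 powr (real_of_int N - real_of_int j)) powr (d / P))
        * ennreal (2 powr (real_of_int j * d / 2))"
      using a error_const_nonneg osc_nonneg by (simp flip: ennreal_mult)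
    then show ?thesis
      by (simp add: besov_term_def mult.assoc[symmetric] mult.commute[of "lp_norm _ _ _"])
  qed
  finally show ?thesis .
qed

lemma besov_term_low_frequency:
  assumes [measurable]: "f \<in> borel_measurable M" and P: "1 \<le> P"
  shows "besov_term (ennreal P) f j
    \<le> ennreal (coeff_const P powr (1 / P) * 2 powr (real_of_int j * (d / P))) * Lp_norm M (ennreal P) f"
proof -
  have "lp_norm (I j) (ennreal P) (coeff f j)
      \<le> ennpow (ennreal (coeff_const P * 2 powr (real_of_int j * d * (1 - P / 2)))
        * (\<integral>\<^sup>+x. ennpow (ennreal (norm (f x))) P \<partial>M)) (1 / P)"
    using P by (simp add: Lp_norm_ennreal ennpow_mono coeff_power_sum_le)
  also have "\<dots> = ennreal ((coeff_const P * 2 powr (real_of_int j * d * (1 - P / 2))) powr (1 / P))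
      * Lp_norm M (ennreal P) f"
    using P coeff_const_nonneg by (simp add: ennpow_mult ennpow_ennreal Lp_norm_ennreal)
  finally have "besov_term (ennreal P) f j \<le> ennreal (2 powr (real_of_int j * d / 2))
      * (ennreal ((coeff_const P * 2 powr (real_of_int j * d * (1 - P / 2))) powr (1 / P))
      * Lp_norm M (ennreal P) f)"
    unfolding besov_term_def by (intro mult_left_mono) auto
  also have "\<dots> = ennreal (2 powr (real_of_int j * d / 2)
      * (coeff_const P * 2 powr (real_of_int j * d * (1 - P / 2))) powr (1 / P)) * Lp_norm M (ennreal P) f"
    by (simp add: ennreal_mult mult.assoc)
  also have "2 powr (real_of_int j * d / 2)
      * (coeff_const P * 2 powr (real_of_int j * d * (1 - P / 2))) powr (1 / P)
    = coeff_const P powr (1 / P) * 2 powr (real_of_int j * (d / P))"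
  proof -
    have "real_of_int j * d / 2 + real_of_int j * d * (1 - P / 2) / P = real_of_int j * (d / P)"
      using P by (simp add: field_simps)
    then show ?thesis
      using coeff_const_nonneg by (simp add: powr_mult powr_powr powr_add[symmetric])
  qed
  finally show ?thesis .
qed

text \<open>The two summands bound the contributions of the generations \<open>j \<ge> n\<close> and \<open>j < n\<close>.\<close>

definition sampling_error :: "real \<Rightarrow> real \<Rightarrow> nat \<Rightarrow> real" where
  "sampling_error P K n = 2 * error_const P * K * 2 powr (- (d / P) * real n)
     + error_const P * coeff_const P powr (1 / P) * r\<^sub>1 powr \<theta> / (2 powr \<theta> - 1) * 2 powr (- \<theta> * real n)"

lemma sampling_error_nonneg: "0 \<le> K \<Longrightarrow> 0 \<le> sampling_error P K n"
  using error_const_nonneg theta_pos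
  by (auto simp: sampling_error_def ge_one_powr_ge_zero
      intro!: add_nonneg_nonneg divide_nonneg_nonneg mult_nonneg_nonneg)

lemma sampling_error_tendsto_0:
  assumes "0 < P" shows "sampling_error P K \<longlonglongrightarrow> 0"
proof -
  have "(\<lambda>n. 2 powr (- c * real n)) \<longlonglongrightarrow> 0" if "0 < c" for c :: real
  proof -
    have "(\<lambda>n. (2 powr (- c)) ^ n) \<longlonglongrightarrow> 0"
      using that by (intro LIMSEQ_power_zero) (simp add: powr_less_one)
    then show ?thesis by (simp add: powr_powr flip: powr_realpow)
  qed
  from this[of "d / P"] this[of \<theta>] show ?thesis
    using assms d_pos theta_pos unfolding sampling_error_def[abs_def]
    by (auto intro!: tendsto_add_zero tendsto_mult_right_zero)
qed

text \<open>Sampling at generation \<open>2 n\<close>, frequencies are split at generation \<open>n\<close>. Above it, the generations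
  are controlled by the Besov norm, whose critical smoothness leaves a gain \<open>2\<^bsup>-nd/p\<^esup>\<close>. Below it, they
  are controlled by the Lebesgue norm, and the variation of the wavelets on the cubes is smaller than
  their size by a factor of order \<open>2\<^bsup>(j-2n)\<theta>\<^esup>\<close>.\<close>

lemma total_error_le:
  assumes [measurable]: "f \<in> borel_measurable M" and P: "1 \<le> P" and K: "0 < K"
    and besov: "(\<integral>\<^sup>+j. besov_term (ennreal P) f j \<partial>count_space UNIV) \<le> ennreal K * Lp_norm M (ennreal P) f"
  shows "(\<integral>\<^sup>+k. ennpow (\<integral>\<^sup>+j. cube_error P f j (2 * int n) k \<partial>count_space UNIV) P \<partial>count_space (I (2 * int n)))
    \<le> ennreal (2 powr (2 * real n * d) * sampling_error P K n powr P)
      * (\<integral>\<^sup>+x. ennpow (ennreal (norm (f x))) P \<partial>M)"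
proof -
  define F where "F = Lp_norm M (ennreal P) f"
  define m where "m j = max 1 (2 powr (2 * real n - real_of_int j)) powr (d / P)" for j :: int
  define B where "B j = ennreal (error_const P * osc j (2 * int n) * m j) * besov_term (ennreal P) f j" for j
  define \<beta> where "\<beta> = 2 * error_const P * 2 powr (real n * (d / P))"
  define \<alpha> where "\<alpha> = error_const P * coeff_const P powr (1 / P) * r\<^sub>1 powr \<theta>
    * 2 powr (- 2 * real n * \<theta>) * 2 powr (2 * real n * (d / P))"
  have \<alpha>: "0 \<le> \<alpha>" and \<beta>: "0 \<le> \<beta>" using error_const_nonneg by (auto simp: \<alpha>_def \<beta>_def)
  have B_le: "B j \<le> ennreal \<beta> * besov_term (ennreal P) f j
      + ennreal \<alpha> * F * (ennreal (2 powr (real_of_int j * \<theta>)) * indicator {..<int n} j)" for j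
  proof (cases "j < int n")
    case False
    have "max 1 (2 powr (2 * real n - real_of_int j)) \<le> 2 powr real n"
    proof -
      have "real n \<le> real_of_int j" using False by linarith
      then show ?thesis by (auto intro: ge_one_powr_ge_zero powr_mono)
    qed
    then have "m j \<le> (2 powr real n) powr (d / P)"
      using P d_pos unfolding m_def by (intro powr_mono2) auto
    then have "osc j (2 * int n) * m j \<le> 2 * 2 powr (real n * (d / P))"
      using osc_nonneg by (intro mult_mono) (auto simp: osc_def powr_powr m_def)
    then have "error_const P * osc j (2 * int n) * m j \<le> \<beta>"
      using mult_left_mono[OF _ error_const_nonneg[of P]] by (fastforce simp: \<beta>_def mult_ac)
    then have "B j \<le> ennreal \<beta> * besov_term (ennreal P) f j"
      unfolding B_def by (intro mult_right_mono ennreal_leI) auto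
    then show ?thesis using False by simp
  next
    case True
    have m: "m j = 2 powr (2 * real n * (d / P)) * 2 powr (- real_of_int j * (d / P))"
    proof -
      have "0 \<le> 2 * real n - real_of_int j" using True by linarith
      then have "m j = (2 powr (2 * real n - real_of_int j)) powr (d / P)"
        by (simp add: m_def max_absorb2 ge_one_powr_ge_zero)
      then show ?thesis by (simp add: powr_powr powr_add[symmetric] algebra_simps)
    qed
    have osc: "osc j (2 * int n) \<le> 2 powr (real_of_int j * \<theta>) * (r\<^sub>1 powr \<theta> * 2 powr (- 2 * real n * \<theta>))"
      using r1_pos by (simp add: osc_def powr_mult powr_powr)
    have m0: "0 \<le> m j" by (simp add: m_def)
    have "B j \<le> ennreal (error_const P * osc j (2 * int n) * m j)
        * (ennreal (coeff_const P powr (1 / P) * 2 powr (real_of_int j * (d / P))) * F)"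
      unfolding B_def F_def by (intro mult_left_mono besov_term_low_frequency P) auto
    also have "\<dots> = ennreal (error_const P * osc j (2 * int n) * m j
        * (coeff_const P powr (1 / P) * 2 powr (real_of_int j * (d / P)))) * F"
      using error_const_nonneg osc_nonneg m0 by (simp add: ennreal_mult mult.assoc)
    also have "\<dots> \<le> ennreal (error_const P * (2 powr (real_of_int j * \<theta>)
        * (r\<^sub>1 powr \<theta> * 2 powr (- 2 * real n * \<theta>))) * m j
        * (coeff_const P powr (1 / P) * 2 powr (real_of_int j * (d / P)))) * F"
      using error_const_nonneg m0 by (intro mult_right_mono ennreal_leI mult_left_mono osc) auto
    also have "error_const P * (2 powr (real_of_int j * \<theta>)
        * (r\<^sub>1 powr \<theta> * 2 powr (- 2 * real n * \<theta>))) * m j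
        * (coeff_const P powr (1 / P) * 2 powr (real_of_int j * (d / P)))
        = \<alpha> * 2 powr (real_of_int j * \<theta>)"
    proof -
      have "2 powr (- real_of_int j * (d / P)) * 2 powr (real_of_int j * (d / P)) = (1 :: real)"
        by (simp flip: powr_add)
      then show ?thesis unfolding m \<alpha>_def by (simp add: algebra_simps)
    qed
    also have "ennreal (\<alpha> * 2 powr (real_of_int j * \<theta>)) * F
        = ennreal \<alpha> * F * (ennreal (2 powr (real_of_int j * \<theta>)) * indicator {..<int n} j)"
      using True \<alpha> by (simp add: ennreal_mult mult_ac)
    finally show ?thesis by (simp add: add_increasing)
  qed
  have "(\<integral>\<^sup>+j. B j \<partial>count_space UNIV)
      \<le> (\<integral>\<^sup>+j. ennreal \<beta> * besov_term (ennreal P) f j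
      + ennreal \<alpha> * F * (ennreal (2 powr (real_of_int j * \<theta>)) * indicator {..<int n} j) \<partial>count_space UNIV)"
    by (intro nn_integral_mono B_le)
  also have "\<dots> = ennreal \<beta> * (\<integral>\<^sup>+j. besov_term (ennreal P) f j \<partial>count_space UNIV)
      + ennreal \<alpha> * F * ennreal (2 powr (real n * \<theta>) / (2 powr \<theta> - 1))"
    by (simp add: nn_integral_add nn_integral_cmult nn_integral_lessThan_geometric_int theta_pos)
  also have "\<dots> \<le> ennreal \<beta> * (ennreal K * F) + ennreal \<alpha> * F * ennreal (2 powr (real n * \<theta>) / (2 powr \<theta> - 1))"
    unfolding F_def by (intro add_right_mono mult_left_mono besov) auto
  also have "\<dots> = ennreal (\<beta> * K + \<alpha> * (2 powr (real n * \<theta>) / (2 powr \<theta> - 1))) * F"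
  proof -
    define G where "G = 2 powr (real n * \<theta>) / (2 powr \<theta> - 1)"
    have "0 \<le> G" using theta_pos by (simp add: G_def ge_one_powr_ge_zero)
    then show ?thesis
      unfolding G_def[symmetric]
      using \<alpha> \<beta> K by (simp add: ennreal_mult ennreal_plus distrib_right distrib_left mult_ac)
  qed
  also have "\<beta> * K + \<alpha> * (2 powr (real n * \<theta>) / (2 powr \<theta> - 1))
      = 2 powr (2 * real n * (d / P)) * sampling_error P K n"
  proof -
    have 1: "2 powr (2 * real n * (d / P)) * 2 powr (- (d / P) * real n) = 2 powr (real n * (d / P))"
      and 2: "2 powr (- 2 * real n * \<theta>) * 2 powr (real n * \<theta>) = 2 powr (- \<theta> * real n)"
      by (simp_all add: algebra_simps flip: powr_add)
    have "2 powr (2 * real n * (d / P)) * sampling_error P K n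
      = 2 * error_const P * K * (2 powr (2 * real n * (d / P)) * 2 powr (- (d / P) * real n))
        + error_const P * coeff_const P powr (1 / P) * r\<^sub>1 powr \<theta> / (2 powr \<theta> - 1)
          * 2 powr (2 * real n * (d / P)) * 2 powr (- \<theta> * real n)"
      by (simp add: sampling_error_def distrib_left mult_ac)
    also have "\<dots> = \<beta> * K + \<alpha> * (2 powr (real n * \<theta>) / (2 powr \<theta> - 1))"
      unfolding 1 2[symmetric] by (simp add: \<alpha>_def \<beta>_def)
    finally show ?thesis by simp
  qed
  finally have B_sum: "(\<integral>\<^sup>+j. B j \<partial>count_space UNIV)
      \<le> ennreal (2 powr (2 * real n * (d / P)) * sampling_error P K n) * F" .
  have "(\<integral>\<^sup>+k. ennpow (\<integral>\<^sup>+j. cube_error P f j (2 * int n) k \<partial>count_space UNIV) P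
      \<partial>count_space (I (2 * int n))) \<le> ennpow (\<integral>\<^sup>+j. B j \<partial>count_space UNIV) P"
    using cube_error_power_sum_le[OF P, where f=f and N="2 * int n"]
    by (intro nn_integral_Minkowski P) (auto simp: B_def m_def)
  also have "\<dots> \<le> ennpow (ennreal (2 powr (2 * real n * (d / P)) * sampling_error P K n) * F) P"
    using P by (intro ennpow_mono B_sum) auto
  also have "\<dots> = ennreal ((2 powr (2 * real n * (d / P)) * sampling_error P K n) powr P)
      * (\<integral>\<^sup>+x. ennpow (ennreal (norm (f x))) P \<partial>M)"
    using P sampling_error_nonneg[of K P n] K
    by (simp add: ennpow_mult ennpow_ennreal F_def ennpow_Lp_norm)
  also have "(2 powr (2 * real n * (d / P)) * sampling_error P K n) powr P
      = 2 powr (2 * real n * d) * sampling_error P K n powr P"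
    using P sampling_error_nonneg[of K P n] K by (simp add: powr_mult powr_powr)
  finally show ?thesis .
qed

text \<open>On each cube \<open>f\<close> and its value at the center differ by at most the cube error. Integrating the
  \<open>p\<close>-th powers over the cubes compares the two norms up to the total error, which is absorbed because
  \<open>\<parallel>f\<parallel>\<^sub>p\<close> is finite.\<close>

lemma sampling_finite_exponent:
  assumes P: "1 \<le> P" and K: "0 < K"
  obtains S c\<^sub>1 c\<^sub>2 where "S \<subseteq> space M" "countable S" "0 < c\<^sub>1" "0 < c\<^sub>2"
    "\<And>f. f \<in> borel_measurable M \<Longrightarrow> (\<And>x. x \<in> space M \<Longrightarrow> f x = wavelet_sum M I \<phi> \<psi> f x) \<Longrightarrow>
      Lp_norm M (ennreal P) f < \<infinity> \<Longrightarrow>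
      (\<integral>\<^sup>+j. besov_term (ennreal P) f j \<partial>count_space UNIV) \<le> ennreal K * Lp_norm M (ennreal P) f \<Longrightarrow>
      ennreal c\<^sub>1 * Lp_norm M (ennreal P) f \<le> lp_norm S (ennreal P) f \<and>
      lp_norm S (ennreal P) f \<le> ennreal c\<^sub>2 * Lp_norm M (ennreal P) f"
proof -
  \<comment> \<open>The factor \<open>2 powr P\<close> is lost in \<open>ennpow_add_le\<close>; half of the norm may be absorbed.\<close>
  have "(\<lambda>n. C * r\<^sub>1 powr d * sampling_error P K n powr P) \<longlonglongrightarrow> C * r\<^sub>1 powr d * 0"
    using P K sampling_error_nonneg[of K P]
    by (intro tendsto_mult_left tendsto_zero_powrI[OF sampling_error_tendsto_0 tendsto_const]) auto
  then have "\<forall>\<^sub>F n in sequentially. C * r\<^sub>1 powr d * sampling_error P K n powr P < 1 / 2 / 2 powr P"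
    by (intro order_tendstoD(2)) auto
  then obtain n where n: "C * r\<^sub>1 powr d * sampling_error P K n powr P < 1 / 2 / 2 powr P"
    by (auto simp: eventually_sequentially)
  define N where "N = 2 * int n"
  define S where "S = y N ` I N"
  define m\<^sub>2 where "m\<^sub>2 = C * (r\<^sub>1 * 2 powr (- real_of_int N)) powr d"
  have m2: "0 < m\<^sub>2" using C_pos r1_pos by (simp add: m\<^sub>2_def)
  obtain m\<^sub>1 where m1: "0 < m\<^sub>1" "\<And>k. k \<in> I N \<Longrightarrow> ennreal m\<^sub>1 \<le> emeasure M (Q N k)"
    using cube_volume_uniformly_pos[of N] by blast
  have m2_le: "emeasure M (Q N k) \<le> ennreal m\<^sub>2" if "k \<in> I N" for k
    unfolding m\<^sub>2_def by (rule cube_volume_upper[OF that])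
  define c\<^sub>1 where "c\<^sub>1 = (1 / (2 * 2 powr P * m\<^sub>2)) powr (1 / P)"
  define c\<^sub>2 where "c\<^sub>2 = (2 * 2 powr P / m\<^sub>1) powr (1 / P)"
  have c: "0 < c\<^sub>1" "0 < c\<^sub>2" using m1(1) m2 by (auto simp: c\<^sub>1_def c\<^sub>2_def)
  show thesis
  proof (rule that[of S c\<^sub>1 c\<^sub>2])
    fix f
    assume [measurable]: "f \<in> borel_measurable M"
      and eq: "\<And>x. x \<in> space M \<Longrightarrow> f x = wavelet_sum M I \<phi> \<psi> f x"
      and fin: "Lp_norm M (ennreal P) f < \<infinity>"
      and besov: "(\<integral>\<^sup>+j. besov_term (ennreal P) f j \<partial>count_space UNIV) \<le> ennreal K * Lp_norm M (ennreal P) f"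
    define h :: real where "h = 1 / 2"
    have h: "0 \<le> h" by (simp add: h_def)
    define g where "g x = ennpow (ennreal (norm (f x))) P" for x
    define a where "a k = ennpow (ennreal (norm (f (y N k)))) P" for k
    define e where "e k = ennpow (\<integral>\<^sup>+j. cube_error P f j N k \<partial>count_space UNIV) P" for k
    define T where "T = (\<integral>\<^sup>+x. g x \<partial>M)"
    define s where "s = (\<integral>\<^sup>+k. a k \<partial>count_space (I N))"
    define E where "E = (\<integral>\<^sup>+k. e k \<partial>count_space (I N))"
    have [measurable]: "g \<in> borel_measurable M" by (simp add: g_def[abs_def])
    have [measurable]: "Q N k \<in> sets M" if "k \<in> I N" for k using Q_sets that by blast
    have T: "T = ennpow (Lp_norm M (ennreal P) f) P"
      using P by (simp add: T_def g_def ennpow_Lp_norm)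
    have T_fin: "T < \<infinity>" using fin by (simp add: T ennpow_finite)
    have s: "lp_norm S (ennreal P) f = ennpow s (1 / P)"
    proof -
      have "bij_betw (y N) (I N) S" using center_inj by (simp add: S_def bij_betw_def)
      then have "(\<integral>\<^sup>+x. g x \<partial>count_space S) = s"
        unfolding s_def a_def g_def by (rule nn_integral_bij_count_space[symmetric])
      then show ?thesis using P by (simp add: Lp_norm_ennreal g_def)
    qed
    have "ennreal m\<^sub>2 * E \<le> ennreal m\<^sub>2 * (ennreal (2 powr (2 * real n * d) * sampling_error P K n powr P) * T)"
      unfolding E_def e_def N_def T_def g_def using P K besov
      by (intro mult_left_mono total_error_le) auto
    also have "\<dots> = ennreal (C * r\<^sub>1 powr d * sampling_error P K n powr P) * T"
    proof -
      have "m\<^sub>2 * 2 powr (2 * real n * d) = C * r\<^sub>1 powr d"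
        using r1_pos by (simp add: m\<^sub>2_def N_def powr_mult powr_powr mult.assoc flip: powr_add)
      then have *: "m\<^sub>2 * (2 powr (2 * real n * d) * sampling_error P K n powr P)
          = C * r\<^sub>1 powr d * sampling_error P K n powr P" by (metis mult.assoc)
      have "ennreal m\<^sub>2 * ennreal (2 powr (2 * real n * d) * sampling_error P K n powr P)
          = ennreal (C * r\<^sub>1 powr d * sampling_error P K n powr P)"
        using m2 by (subst ennreal_mult[symmetric]) (simp_all add: *)
      then show ?thesis by (simp add: mult.assoc[symmetric])
    qed
    also have "\<dots> \<le> ennreal (h / 2 powr P) * T"
      using n by (intro mult_right_mono ennreal_leI) (auto simp: h_def)
    finally have E: "ennreal (2 powr P) * (ennreal m\<^sub>2 * E) \<le> ennreal h * T"
      using mult_left_mono[of "ennreal m\<^sub>2 * E" "ennreal (h / 2 powr P) * T" "ennreal (2 powr P)"]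
      using h by (simp add: mult.assoc[symmetric] flip: ennreal_mult)
    have besov_fin: "(\<integral>\<^sup>+j. besov_term (ennreal P) f j \<partial>count_space UNIV) < \<infinity>"
      using fin by (intro le_less_trans[OF besov]) (simp add: ennreal_mult_less_top)
    have osc: "ennreal (norm (f x - f (y N k))) \<le> (\<integral>\<^sup>+j. cube_error P f j N k \<partial>count_space UNIV)"
      if "k \<in> I N" "x \<in> Q N k" for k x
    proof -
      have "x \<in> space M" using that Q_sets sets.sets_into_space by blast
      then show ?thesis
        using cube_oscillation[OF P besov_fin that] by (simp add: eq center_space[OF that(1)])
    qed
    have on_cube: "g x \<le> ennreal (2 powr P) * (a k + e k)" "a k \<le> ennreal (2 powr P) * (g x + e k)"
      if "k \<in> I N" "x \<in> Q N k" for k x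
    proof -
      have *: "ennpow (ennreal (norm u)) P \<le> ennreal (2 powr P) * (ennpow (ennreal (norm v)) P + e k)"
        if "ennreal (norm (u - v)) \<le> (\<integral>\<^sup>+j. cube_error P f j N k \<partial>count_space UNIV)" for u v :: complex
      proof -
        have "ennreal (norm u) \<le> ennreal (norm v) + ennreal (norm (u - v))"
          using norm_triangle_sub[of u v] by (simp flip: ennreal_plus)
        also have "\<dots> \<le> ennreal (norm v) + (\<integral>\<^sup>+j. cube_error P f j N k \<partial>count_space UNIV)"
          by (intro add_left_mono that)
        finally have "ennpow (ennreal (norm u)) P
            \<le> ennpow (ennreal (norm v) + (\<integral>\<^sup>+j. cube_error P f j N k \<partial>count_space UNIV)) P"
          using P by (intro ennpow_mono) auto
        also have "\<dots> \<le> ennreal (2 powr P) * (ennpow (ennreal (norm v)) P + e k)"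
          unfolding e_def using P by (intro ennpow_add_le) auto
        finally show ?thesis .
      qed
      show "g x \<le> ennreal (2 powr P) * (a k + e k)" "a k \<le> ennreal (2 powr P) * (g x + e k)"
        unfolding g_def a_def using osc[OF that] by (auto intro!: * simp: norm_minus_commute)
    qed
    have cubes: "T = (\<integral>\<^sup>+k. \<integral>\<^sup>+x. g x * indicator (Q N k) x \<partial>M \<partial>count_space (I N))"
      unfolding T_def by (rule nn_integral_cubes[symmetric]) simp
    have upper: "T \<le> ennreal (2 powr P) * (ennreal m\<^sub>2 * s) + ennreal (2 powr P) * (ennreal m\<^sub>2 * E)"
    proof -
      have "T \<le> (\<integral>\<^sup>+k. ennreal (2 powr P) * ennreal m\<^sub>2 * (a k + e k) \<partial>count_space (I N))"
        unfolding cubes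
      proof (rule nn_integral_mono)
        fix k assume "k \<in> space (count_space (I N))"
        then have k: "k \<in> I N" by simp
        have "(\<integral>\<^sup>+x. g x * indicator (Q N k) x \<partial>M)
            \<le> (\<integral>\<^sup>+x. ennreal (2 powr P) * (a k + e k) * indicator (Q N k) x \<partial>M)"
          using on_cube(1)[OF k] by (intro nn_integral_mono) (auto split: split_indicator)
        also have "\<dots> = ennreal (2 powr P) * (a k + e k) * emeasure M (Q N k)"
          using k by (intro nn_integral_cmult_indicator) simp
        also have "\<dots> \<le> ennreal (2 powr P) * (a k + e k) * ennreal m\<^sub>2"
          by (intro mult_left_mono m2_le k) auto
        finally show "(\<integral>\<^sup>+x. g x * indicator (Q N k) x \<partial>M)
            \<le> ennreal (2 powr P) * ennreal m\<^sub>2 * (a k + e k)" by (simp add: mult_ac)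
      qed
      also have "\<dots> = ennreal (2 powr P) * ennreal m\<^sub>2 * (s + E)"
        by (simp add: nn_integral_cmult nn_integral_add s_def E_def)
      finally show ?thesis by (simp add: distrib_left mult.assoc)
    qed
    have lower: "ennreal m\<^sub>1 * s \<le> ennreal (2 powr P) * T + ennreal (2 powr P) * (ennreal m\<^sub>2 * E)"
    proof -
      have "ennreal m\<^sub>1 * s = (\<integral>\<^sup>+k. ennreal m\<^sub>1 * a k \<partial>count_space (I N))"
        by (simp add: s_def nn_integral_cmult)
      also have "\<dots> \<le> (\<integral>\<^sup>+k. ennreal (2 powr P)
          * ((\<integral>\<^sup>+x. g x * indicator (Q N k) x \<partial>M) + ennreal m\<^sub>2 * e k) \<partial>count_space (I N))"
      proof (rule nn_integral_mono)
        fix k assume "k \<in> space (count_space (I N))"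
        then have k: "k \<in> I N" by simp
        have "ennreal m\<^sub>1 * a k \<le> emeasure M (Q N k) * a k"
          by (intro mult_right_mono m1 k) auto
        also have "\<dots> = (\<integral>\<^sup>+x. a k * indicator (Q N k) x \<partial>M)"
          using k by (simp add: nn_integral_cmult_indicator mult.commute)
        also have "\<dots> \<le> (\<integral>\<^sup>+x. ennreal (2 powr P)
            * (g x * indicator (Q N k) x + e k * indicator (Q N k) x) \<partial>M)"
          using on_cube(2)[OF k] by (intro nn_integral_mono) (auto split: split_indicator)
        also have "\<dots> = ennreal (2 powr P)
            * ((\<integral>\<^sup>+x. g x * indicator (Q N k) x \<partial>M) + e k * emeasure M (Q N k))"
          using k by (simp add: nn_integral_cmult nn_integral_add nn_integral_cmult_indicator)
        also have "\<dots> \<le> ennreal (2 powr P)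
            * ((\<integral>\<^sup>+x. g x * indicator (Q N k) x \<partial>M) + e k * ennreal m\<^sub>2)"
          by (intro mult_left_mono add_left_mono m2_le k) auto
        finally show "ennreal m\<^sub>1 * a k \<le> ennreal (2 powr P)
            * ((\<integral>\<^sup>+x. g x * indicator (Q N k) x \<partial>M) + ennreal m\<^sub>2 * e k)" by (simp add: mult_ac)
      qed
      also have "\<dots> = ennreal (2 powr P) * (T + ennreal m\<^sub>2 * E)"
        by (simp add: nn_integral_cmult nn_integral_add cubes[symmetric] E_def)
      finally show ?thesis by (simp add: distrib_left)
    qed
    have T_le: "ennreal (1 / (2 * 2 powr P * m\<^sub>2)) * T \<le> s"
    proof (cases s)
      case (real \<sigma>)
      obtain t where t: "0 \<le> t" "T = ennreal t" using T_fin by (cases T) auto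
      have "T \<le> ennreal (2 powr P) * (ennreal m\<^sub>2 * s) + ennreal h * T"
        using upper E by (rule order_trans[OF _ add_left_mono])
      then have "t \<le> 2 powr P * (m\<^sub>2 * \<sigma>) + h * t"
        using real t m2 h by (simp flip: ennreal_mult ennreal_plus)
      then show ?thesis using real t m2 by (simp add: h_def field_simps flip: ennreal_mult)
    qed simp
    have s_le: "s \<le> ennreal (2 * 2 powr P / m\<^sub>1) * T"
    proof -
      obtain t where t: "0 \<le> t" "T = ennreal t" using T_fin by (cases T) auto
      have "ennreal m\<^sub>1 * s \<le> ennreal (2 powr P) * T + ennreal h * T"
        using lower E by (rule order_trans[OF _ add_left_mono])
      also have "\<dots> = ennreal (2 powr P * t + h * t)"
        using t h by (simp flip: ennreal_mult ennreal_plus)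
      finally have le: "ennreal m\<^sub>1 * s \<le> ennreal (2 powr P * t + h * t)" .
      show ?thesis
      proof (cases s)
        case (real \<sigma>)
        have "m\<^sub>1 * \<sigma> \<le> 2 powr P * t + h * t"
          using le real t m1(1) h by (simp flip: ennreal_mult ennreal_plus)
        also have "\<dots> \<le> 2 powr P * t + 2 powr P * t"
          using t P ge_one_powr_ge_zero[of 2 P] by (intro add_left_mono mult_right_mono) (auto simp: h_def)
        finally have "\<sigma> \<le> 2 * 2 powr P / m\<^sub>1 * t" using m1(1) by (simp add: field_simps)
        then show ?thesis using real t m1(1) by (simp flip: ennreal_mult)
      next
        case top
        then show ?thesis using le m1(1) by (simp add: ennreal_mult_top top_unique)
      qed
    qed
    have root: "ennreal (b powr (1 / P)) * Lp_norm M (ennreal P) f = ennpow (ennreal b * T) (1 / P)"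
      if "0 \<le> b" for b
      using P that by (simp add: ennpow_mult ennpow_ennreal T ennpow_inverse)
    show "ennreal c\<^sub>1 * Lp_norm M (ennreal P) f \<le> lp_norm S (ennreal P) f \<and>
      lp_norm S (ennreal P) f \<le> ennreal c\<^sub>2 * Lp_norm M (ennreal P) f"
      unfolding c\<^sub>1_def c\<^sub>2_def s using m1(1) m2 P T_le s_le
      by (subst (1 2) root) (auto intro!: ennpow_mono)
  qed (use c center_space countable_I in \<open>auto simp: S_def\<close>)
qed

end


section \<open>The sampling theorem\<close>

lemma Lp_norm_const:
  assumes p: "1 \<le> p" and v: "\<And>x. x \<in> space N \<Longrightarrow> f x = v"
    and m: "0 < m" "emeasure N (space N) = ennreal m"
  shows "Lp_norm N p f = ennreal (m powr enn2real (1 / p)) * ennreal (norm v)"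
proof -
  have "(\<lambda>x. ennreal (norm (f x))) \<in> borel_measurable N"
    by (subst measurable_cong[of _ _ "\<lambda>_. ennreal (norm v)"]) (simp_all add: v)
  moreover have "(\<lambda>x. ennreal (norm v)) \<in> borel_measurable N" by simp
  moreover have "AE x in N. ennreal (norm (f x)) = ennreal (norm v)" by (rule AE_I2) (simp add: v)
  ultimately have "esssup N (\<lambda>x. ennreal (norm (f x))) = esssup N (\<lambda>x. ennreal (norm v))"
    by (rule esssup_AE_cong)
  also have "\<dots> = ennreal (norm v)" using m by (intro esssup_const) simp
  finally have sup: "esssup N (\<lambda>x. ennreal (norm (f x))) = ennreal (norm v)" .
  show ?thesis
  proof (cases p)
    case (real P)
    then have P: "1 \<le> P" using p by simp
    have "(\<integral>\<^sup>+x. ennpow (ennreal (norm (f x))) P \<partial>N) = (\<integral>\<^sup>+x. ennpow (ennreal (norm v)) P \<partial>N)"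
      by (intro nn_integral_cong) (simp add: v)
    also have "\<dots> = ennpow (ennreal (norm v)) P * ennreal m" by (simp add: m)
    finally have "Lp_norm N p f = ennpow (ennpow (ennreal (norm v)) P * ennreal m) (1 / P)"
      using real by (simp add: Lp_norm_ennreal)
    also have "\<dots> = ennreal (m powr (1 / P)) * ennreal (norm v)"
      using P m by (subst ennpow_mult) (simp_all add: ennpow_inverse ennpow_ennreal[of m] mult.commute)
    also have "1 / P = enn2real (1 / p)"
      using real P by (simp add: divide_ennreal flip: ennreal_1)
    finally show ?thesis .
  next
    case top
    then show ?thesis using m(1) by (simp add: Lp_norm_def Lp_ennnorm_def sup)
  qed
qed

lemma Lp_norm_eq_0:
  assumes p: "1 \<le> p" and f: "\<And>x. x \<in> space N \<Longrightarrow> f x = 0"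
  shows "Lp_norm N p f = 0"
proof (cases "p = \<infinity>")
  case True
  have "(\<lambda>x. ennreal (norm (f x))) \<in> borel_measurable N"
    by (subst measurable_cong[of _ _ "\<lambda>_. 0"]) (simp_all add: f)
  then have "esssup N (\<lambda>x. ennreal (norm (f x))) \<le> 0"
    by (rule esssup_I) (simp add: f)
  then show ?thesis using True by (simp add: Lp_norm_def Lp_ennnorm_def)
next
  case False
  have "(\<integral>\<^sup>+x. ennpow (ennreal (norm (f x))) (enn2real p) \<partial>N) = (\<integral>\<^sup>+x. 0 \<partial>N)"
    by (intro nn_integral_cong) (simp add: f)
  then show ?thesis using False by (simp add: Lp_norm_def Lp_ennnorm_def)
qed

text \<open>At an atom without mass all coefficients vanish, and with them the function.\<close>

lemma sampling_one_point:
  assumes p: "1 \<le> p" and X: "\<And>x z. x \<in> space M \<Longrightarrow> z \<in> space M \<Longrightarrow> x = z"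
    and fin: "emeasure M (space M) < \<infinity>"
  obtains c where "0 < c"
    "\<And>f. (\<And>x. x \<in> space M \<Longrightarrow> f x = wavelet_sum M I \<phi> \<psi> f x) \<Longrightarrow>
      lp_norm (space M) p f = ennreal c * Lp_norm M p f"
proof -
  obtain m where m: "0 \<le> m" "emeasure M (space M) = ennreal m"
    using fin by (cases "emeasure M (space M)") auto
  show thesis
  proof (cases "m = 0")
    case True
    then have "space M \<in> null_sets M" using m by auto
    then have null: "AE x in M. P x" for P
      by (rule AE_I') auto
    show thesis
    proof (rule that[of 1])
      fix f assume eq: "\<And>x. x \<in> space M \<Longrightarrow> f x = wavelet_sum M I \<phi> \<psi> f x"
      have "inner_L2 M f u = 0" for u
        unfolding inner_L2_def by (rule integral_eq_zero_AE[OF null])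
      then have "f x = 0" if "x \<in> space M" for x
        using eq[OF that] by (simp add: wavelet_sum_def)
      then show "lp_norm (space M) p f = ennreal 1 * Lp_norm M p f"
        using Lp_norm_eq_0[OF p, of M f] Lp_norm_eq_0[OF p, of "count_space (space M)" f] by simp
    qed simp
  next
    case False
    then have m0: "0 < m" using m by simp
    then have "space M \<noteq> {}" using m by auto
    then obtain a where a: "space M = {a}" using X by blast
    have c: "0 < m powr enn2real (1 / p)" using m0 by simp
    show thesis
    proof (rule that[of "1 / m powr enn2real (1 / p)"])
      fix f :: "'a \<Rightarrow> complex"
      have "Lp_norm M p f = ennreal (m powr enn2real (1 / p)) * ennreal (norm (f a))"
        by (rule Lp_norm_const[OF p _ m0 m(2)]) (simp add: a)
      moreover have "lp_norm (space M) p f = ennreal (1 powr enn2real (1 / p)) * ennreal (norm (f a))"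
        by (rule Lp_norm_const[OF p]) (simp_all add: a)
      ultimately show "lp_norm (space M) p f = ennreal (1 / m powr enn2real (1 / p)) * Lp_norm M p f"
        using c by (simp add: mult.assoc[symmetric] flip: ennreal_mult)
    qed (use c in simp)
  qed
qed

text \<open>Beyond the diameter the upper bound follows from the finiteness of the total measure.\<close>

lemma homogeneous_volume_bounds:
  assumes hom: "homogeneous_type M \<rho> d \<theta>" and diam: "0 < qdiam (space M) \<rho>"
  obtains C where "0 < C"
    "\<And>r x. 0 < r \<Longrightarrow> ereal r < qdiam (space M) \<rho> \<Longrightarrow> x \<in> space M \<Longrightarrow>
      ennreal (r powr d / C) \<le> emeasure M (qball (space M) \<rho> x r)"
    "\<And>r x. 0 < r \<Longrightarrow> x \<in> space M \<Longrightarrow> emeasure M (qball (space M) \<rho> x r) \<le> ennreal (C * r powr d)"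
proof -
  obtain C where C: "0 < C" and vol: "\<And>r x. 0 < r \<Longrightarrow> ereal r < qdiam (space M) \<rho> \<Longrightarrow> x \<in> space M \<Longrightarrow>
      ennreal (r powr d / C) \<le> emeasure M (qball (space M) \<rho> x r) \<and>
      emeasure M (qball (space M) \<rho> x r) \<le> ennreal (C * r powr d)"
    using hom unfolding homogeneous_type_def by blast
  have d: "0 < d" using hom by (simp add: homogeneous_type_def)
  show thesis
  proof (cases "qdiam (space M) \<rho>")
    case PInf
    then show thesis using that[OF C] vol by simp
  next
    case MInf
    then show thesis using diam by simp
  next
    case (real D)
    then have D: "0 < D" using diam by simp
    have "space M \<noteq> {}"
      using diam by (auto simp: qdiam_def bot_ereal_def)
    then obtain a where a: "a \<in> space M" by blast
    have "\<rho> a z < 2 * D" if "z \<in> space M" for z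
      using rho_le_qdiam[OF a that, of \<rho>] real D by simp
    then have "qball (space M) \<rho> a (2 * D) = space M" by (auto simp: qball_def)
    moreover have "emeasure M (qball (space M) \<rho> a (2 * D)) < \<infinity>"
      using hom a D by (simp add: homogeneous_type_def)
    ultimately obtain m where m: "0 \<le> m" "emeasure M (space M) = ennreal m"
      by (cases "emeasure M (space M)") auto
    define C' where "C' = max C (m / D powr d)"
    have C': "0 < C'" "C \<le> C'" "m / D powr d \<le> C'" using C by (auto simp: C'_def)
    show thesis
    proof (rule that[OF C'(1)])
      fix r :: real and x assume r: "0 < r" "ereal r < qdiam (space M) \<rho>" and x: "x \<in> space M"
      have "ennreal (r powr d / C') \<le> ennreal (r powr d / C)"
        using C C' by (intro ennreal_leI divide_left_mono) auto
      then show "ennreal (r powr d / C') \<le> emeasure M (qball (space M) \<rho> x r)"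
        using vol[OF r x] by (meson order_trans)
    next
      fix r :: real and x assume r: "0 < r" and x: "x \<in> space M"
      show "emeasure M (qball (space M) \<rho> x r) \<le> ennreal (C' * r powr d)"
      proof (cases "r < D")
        case True
        then have "emeasure M (qball (space M) \<rho> x r) \<le> ennreal (C * r powr d)"
          using vol[OF r _ x] real by simp
        also have "\<dots> \<le> ennreal (C' * r powr d)"
          using C' by (intro ennreal_leI mult_right_mono) auto
        finally show ?thesis .
      next
        case False
        have "emeasure M (qball (space M) \<rho> x r) \<le> ennreal m"
          using emeasure_space[of M "qball (space M) \<rho> x r"] m by simp
        also have "m = m / D powr d * D powr d" using D by simp
        also have "\<dots> \<le> C' * r powr d"
          using False D d C' by (intro mult_mono powr_mono2) auto
        finally show ?thesis by (simp add: ennreal_leI)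
      qed
    qed
  qed
qed

lemma wavelet_space_exists:
  assumes hom: "homogeneous_type M \<rho> d \<theta>" and cubes: "dyadic_cubes M \<rho> I Q y"
    and wav: "wavelet_system M \<rho> d \<theta> I y \<phi> \<psi>" and diam: "0 < qdiam (space M) \<rho>"
  obtains A C r\<^sub>0 r\<^sub>1 L D \<gamma> where "wavelet_space M \<rho> d I Q y A C r\<^sub>0 r\<^sub>1 \<theta> L D \<gamma> \<phi> \<psi>"
proof -
  let ?X = "space M"
  have qm: "quasi_metric_on ?X \<rho>" and d: "0 < d" and \<theta>: "0 < \<theta>"
    using hom by (auto simp: homogeneous_type_def)
  obtain A where tri: "0 < A" "\<forall>x\<in>?X. \<forall>z\<in>?X. \<forall>u\<in>?X. \<rho> x z \<le> A * (\<rho> x u + \<rho> u z)"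
    using qm[unfolded quasi_metric_on_def, THEN conjunct2] by (elim exE conjE)
  have rho: "\<And>x z. x \<in> ?X \<Longrightarrow> z \<in> ?X \<Longrightarrow> 0 \<le> \<rho> x z"
    "\<And>x z. x \<in> ?X \<Longrightarrow> z \<in> ?X \<Longrightarrow> \<rho> x z = \<rho> z x"
    using qm by (simp_all add: quasi_metric_on_def)
  have A': "\<rho> x z \<le> max 1 A * (\<rho> x u + \<rho> u z)" if "x \<in> ?X" "z \<in> ?X" "u \<in> ?X" for x z u
  proof -
    have "\<rho> x z \<le> A * (\<rho> x u + \<rho> u z)" using tri(2) that by blast
    also have "\<dots> \<le> max 1 A * (\<rho> x u + \<rho> u z)"
      using rho(1) that by (intro mult_right_mono) auto
    finally show ?thesis .
  qed
  obtain C where C: "0 < C"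
    "\<And>r x. 0 < r \<Longrightarrow> ereal r < qdiam ?X \<rho> \<Longrightarrow> x \<in> ?X \<Longrightarrow>
      ennreal (r powr d / C) \<le> emeasure M (qball ?X \<rho> x r)"
    "\<And>r x. 0 < r \<Longrightarrow> x \<in> ?X \<Longrightarrow> emeasure M (qball ?X \<rho> x r) \<le> ennreal (C * r powr d)"
    using homogeneous_volume_bounds[OF hom diam] by blast
  obtain r\<^sub>0 r\<^sub>1 where r: "0 < r\<^sub>0" "0 < r\<^sub>1" and "\<forall>j. \<forall>k\<in>I j. y j k \<in> Q j k \<and>
        qball ?X \<rho> (y j k) (r\<^sub>0 * 2 powr (- real_of_int j)) \<subseteq> Q j k \<and>
        Q j k \<subseteq> qball ?X \<rho> (y j k) (r\<^sub>1 * 2 powr (- real_of_int j))"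
    using cubes unfolding dyadic_cubes_def by (elim conjE exE)
  note inner_outer = this(3)[rule_format]
  have "(\<forall>j. countable (I j)) \<and> (\<forall>j. \<forall>k\<in>I j. Q j k \<in> sets M) \<and> (\<forall>j. ?X = (\<Union>k\<in>I j. Q j k)) \<and>
    (\<forall>j. \<forall>k\<in>I j. \<forall>l\<in>I j. k \<noteq> l \<longrightarrow> Q j k \<inter> Q j l = {})"
    using cubes unfolding dyadic_cubes_def by (elim conjE) (intro conjI; assumption)
  note Q = this[THEN conjunct1, rule_format] this[THEN conjunct2, THEN conjunct1, rule_format]
    this[THEN conjunct2, THEN conjunct2, THEN conjunct1, rule_format]
    this[THEN conjunct2, THEN conjunct2, THEN conjunct2, rule_format]
  obtain L where L: "0 < L" and "\<forall>j. \<forall>k\<in>I j.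
        (\<forall>x\<in>?X. L * 2 powr (- real_of_int j) \<le> \<rho> x (y j k) \<longrightarrow> \<phi> j k x = 0) \<and>
        (\<forall>x\<in>?X. norm (\<phi> j k x) \<le> L * 2 powr (real_of_int j * d / 2)) \<and>
        (\<forall>x\<in>?X. \<forall>x'\<in>?X.
           norm (\<phi> j k x - \<phi> j k x') \<le> L * 2 powr (real_of_int j * (d / 2 + \<theta>)) * \<rho> x x' powr \<theta>)"
    using wav unfolding wavelet_system_def by (elim conjE exE)
  note phi = this(2)[rule_format, THEN conjunct1, rule_format]
    this(2)[rule_format, THEN conjunct2, THEN conjunct1, rule_format]
    this(2)[rule_format, THEN conjunct2, THEN conjunct2, rule_format]
  obtain D \<gamma> where D: "0 < D" "0 < \<gamma>" and "\<forall>j. \<forall>k\<in>I j. \<forall>x\<in>?X.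
        norm (\<psi> j k x) \<le> D * 2 powr (real_of_int j * d / 2)
          * (1 + 2 powr real_of_int j * \<rho> x (y j k)) powr (- (d + \<gamma>))"
    using wav unfolding wavelet_system_def by (elim conjE exE)
  note psi = this(3)[rule_format]
  have "wavelet_space M \<rho> d I Q y (max 1 A) C r\<^sub>0 r\<^sub>1 \<theta> L D \<gamma> \<phi> \<psi>"
  proof
    show "1 \<le> max 1 A" by simp
  qed (fact A' C r(1) r(2) rho d \<theta> diam Q L D phi psi | use inner_outer in blast)+
  then show thesis by (rule that)
qed

theorem mainTheorem1:
  fixes M :: "'a measure" and \<rho> :: "'a \<Rightarrow> 'a \<Rightarrow> real" and d \<theta> :: real
    and I :: "int \<Rightarrow> 'k set" and Q :: "int \<Rightarrow> 'k \<Rightarrow> 'a set" and y :: "int \<Rightarrow> 'k \<Rightarrow> 'a"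
    and \<phi> \<psi> :: "int \<Rightarrow> 'k \<Rightarrow> 'a \<Rightarrow> complex"
    and p :: ennreal and \<epsilon> K :: real
  assumes "homogeneous_type M \<rho> d \<theta>"
    and "dyadic_cubes M \<rho> I Q y"
    and "wavelet_system M \<rho> d \<theta> I y \<phi> \<psi>"
    and "1 \<le> p"
    and "0 < \<epsilon>" and "\<epsilon> < 1" and "0 < K"
  shows "\<exists>A c\<^sub>1 c\<^sub>2. A \<subseteq> space M \<and> countable A \<and> 0 < c\<^sub>1 \<and> 0 < c\<^sub>2 \<and>
    (\<forall>f \<in> besov_space M \<rho> d I \<psi> (d * enn2real (1 / p)) p 1.
       (\<forall>x\<in>space M. f x = wavelet_sum M I \<phi> \<psi> f x) \<longrightarrow>
       Lp_norm M p f < \<infinity> \<longrightarrow>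
       besov_norm M d I \<psi> (d * enn2real (1 / p)) p 1 f \<le> ennreal K * Lp_norm M p f \<longrightarrow>
       ennreal (c\<^sub>1 * (1 - \<epsilon>)) * Lp_norm M p f \<le> lp_norm A p f \<and>
       lp_norm A p f \<le> ennreal (c\<^sub>2 * (1 + \<epsilon>)) * Lp_norm M p f)"
proof -
  let ?B = "besov_norm M d I \<psi> (d * enn2real (1 / p)) p 1"
  have "\<exists>A c\<^sub>1 c\<^sub>2. A \<subseteq> space M \<and> countable A \<and> 0 < c\<^sub>1 \<and> 0 < c\<^sub>2 \<and>
    (\<forall>f \<in> borel_measurable M. (\<forall>x\<in>space M. f x = wavelet_sum M I \<phi> \<psi> f x) \<longrightarrow>
       Lp_norm M p f < \<infinity> \<longrightarrow> ?B f \<le> ennreal K * Lp_norm M p f \<longrightarrow>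
       ennreal c\<^sub>1 * Lp_norm M p f \<le> lp_norm A p f \<and> lp_norm A p f \<le> ennreal c\<^sub>2 * Lp_norm M p f)"
  proof (cases "0 < qdiam (space M) \<rho>")
    case False
    have X: "x = z" if "x \<in> space M" "z \<in> space M" for x z
    proof -
      have "ereal (\<rho> x z) \<le> qdiam (space M) \<rho>" by (rule rho_le_qdiam[OF that])
      also have "\<dots> \<le> 0" using False by (simp add: not_less)
      finally have "\<rho> x z \<le> 0" by simp
      moreover have "0 \<le> \<rho> x z \<and> (\<rho> x z = 0 \<longleftrightarrow> x = z)"
        using assms(1) that by (simp add: homogeneous_type_def quasi_metric_on_def)
      ultimately show ?thesis by linarith
    qed
    have "emeasure M (space M) < \<infinity>"
    proof (cases "space M = {}")
      case False
      then obtain a where a: "a \<in> space M" by blast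
      then have "qball (space M) \<rho> a 1 = space M"
        using X assms(1) by (auto simp: qball_def homogeneous_type_def quasi_metric_on_def)
      moreover have "emeasure M (qball (space M) \<rho> a 1) < \<infinity>"
        using assms(1) a by (simp add: homogeneous_type_def)
      ultimately show ?thesis by simp
    qed simp
    then obtain c where "0 < c" "\<And>f. (\<And>x. x \<in> space M \<Longrightarrow> f x = wavelet_sum M I \<phi> \<psi> f x) \<Longrightarrow>
      lp_norm (space M) p f = ennreal c * Lp_norm M p f"
      using sampling_one_point[OF assms(4) X] by blast
    moreover have "countable (space M)"
    proof (cases "space M = {}")
      case False
      then obtain a where "space M = {a}" using X by blast
      then show ?thesis by simp
    qed simp
    ultimately show ?thesis
      by (intro exI[of _ "space M"] exI[of _ c]) auto
  next
    case True
    obtain A C r\<^sub>0 r\<^sub>1 L D \<gamma> where "wavelet_space M \<rho> d I Q y A C r\<^sub>0 r\<^sub>1 \<theta> L D \<gamma> \<phi> \<psi>"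
      using wavelet_space_exists[OF assms(1-3) True] by blast
    then interpret wavelet_space M \<rho> d I Q y A C r\<^sub>0 r\<^sub>1 \<theta> L D \<gamma> \<phi> \<psi> .
    show ?thesis
    proof (cases p)
      case (real P)
      then have P: "1 \<le> P" using assms(4) by simp
      obtain S c\<^sub>1 c\<^sub>2 where S: "S \<subseteq> space M" "countable S" "0 < c\<^sub>1" "0 < c\<^sub>2"
        and sampling: "\<And>f. f \<in> borel_measurable M \<Longrightarrow>
          (\<And>x. x \<in> space M \<Longrightarrow> f x = wavelet_sum M I \<phi> \<psi> f x) \<Longrightarrow> Lp_norm M p f < \<infinity> \<Longrightarrow>
          (\<integral>\<^sup>+j. besov_term p f j \<partial>count_space UNIV) \<le> ennreal K * Lp_norm M p f \<Longrightarrow>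
          ennreal c\<^sub>1 * Lp_norm M p f \<le> lp_norm S p f \<and> lp_norm S p f \<le> ennreal c\<^sub>2 * Lp_norm M p f"
        using sampling_finite_exponent[OF P assms(7)] unfolding real(2) by blast
      show ?thesis
        unfolding besov_norm_eq using S sampling by (intro exI[of _ S] exI[of _ c\<^sub>1] exI[of _ c\<^sub>2]) auto
    next
      case top
      have "Lp_norm M \<infinity> f = lp_norm (\<Union>j. y j ` I j) \<infinity> f"
        if "f \<in> borel_measurable M" "\<forall>x\<in>space M. f x = wavelet_sum M I \<phi> \<psi> f x"
          "Lp_norm M p f < \<infinity>" "?B f \<le> ennreal K * Lp_norm M p f" for f
      proof (rule esssup_eq_sup_centers)
        show "(\<integral>\<^sup>+j. besov_term p f j \<partial>count_space UNIV) < \<infinity>"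
          using that(3,4) unfolding besov_norm_eq
          by (elim le_less_trans) (simp add: ennreal_mult_less_top)
      qed (use that assms(4) in auto)
      then show ?thesis
        using top center_space countable_I
        by (intro exI[of _ "\<Union>j. y j ` I j"] exI[of _ 1]) auto
    qed
  qed
  then obtain A c\<^sub>1 c\<^sub>2 where A: "A \<subseteq> space M" "countable A" and c: "0 < c\<^sub>1" "0 < c\<^sub>2"
    and sampling: "\<And>f. f \<in> borel_measurable M \<Longrightarrow> \<forall>x\<in>space M. f x = wavelet_sum M I \<phi> \<psi> f x \<Longrightarrow>
      Lp_norm M p f < \<infinity> \<Longrightarrow> ?B f \<le> ennreal K * Lp_norm M p f \<Longrightarrow>
      ennreal c\<^sub>1 * Lp_norm M p f \<le> lp_norm A p f \<and> lp_norm A p f \<le> ennreal c\<^sub>2 * Lp_norm M p f"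
    by blast
  show ?thesis
  proof (rule exI[of _ A], rule exI[of _ c\<^sub>1], rule exI[of _ c\<^sub>2], intro conjI ballI impI A c)
    fix f
    assume "f \<in> besov_space M \<rho> d I \<psi> (d * enn2real (1 / p)) p 1"
      and f: "\<forall>x\<in>space M. f x = wavelet_sum M I \<phi> \<psi> f x"
      "Lp_norm M p f < \<infinity>" "?B f \<le> ennreal K * Lp_norm M p f"
    then have "f \<in> borel_measurable M" by (simp add: besov_space_def L1_loc_def)
    note sampling = sampling[OF this f]
    have "ennreal (c\<^sub>1 * (1 - \<epsilon>)) * Lp_norm M p f \<le> ennreal c\<^sub>1 * Lp_norm M p f"
      using c assms(5) by (intro mult_right_mono ennreal_leI) (auto simp: mult_le_cancel_left1)
    then show "ennreal (c\<^sub>1 * (1 - \<epsilon>)) * Lp_norm M p f \<le> lp_norm A p f"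
      using sampling by (meson order_trans)
    have "ennreal c\<^sub>2 * Lp_norm M p f \<le> ennreal (c\<^sub>2 * (1 + \<epsilon>)) * Lp_norm M p f"
      using c assms(5) by (intro mult_right_mono ennreal_leI) auto
    then show "lp_norm A p f \<le> ennreal (c\<^sub>2 * (1 + \<epsilon>)) * Lp_norm M p f"
      using sampling by (meson order_trans)
  qed
qed

end
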